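(* Let $F\in\mathbb{R}[z_1,\ldots,z_d]$ be a PSD polynomial which is not SOS. Then $F$ has a non-constant Artin minimal denominator $s\in\mathbb{R}[z_1,\ldots,z_d]$. Moreover, the irreducible factors of an Artin minimal denominator of $F$ do not change sign on $\mathbb{R}^d$.
   Context: A polynomial $F\in\mathbb{R}[z_1,\ldots,z_d]$ is positive semidefinite (PSD) if $F(x)\ge 0$ for all $x\in\mathbb{R}^d$, and is a sum of squares (SOS) if $F=h_1^2+\cdots+h_k^2$ for some $h_i\in\mathbb{R}[z_1,\ldots,z_d]$. For a PSD polynomial $F$, a nonzero polynomial $s\in\mathbb{R}[z_1,\ldots,z_d]$ is called an Artin denominator of $F$ if $s^2F$ is SOS. An Artin denominator $s$ of $F$ is called an Artin minimal denominator (also: Artin minimum denominator) if, for each irreducible factor $s_j$ of $s$, the polynomial $s/s_j$ is not an Artin denominator of $F$. A polynomial does not change sign on $\mathbb{R}^d$ if it is either $\ge 0$ on all of $\mathbb{R}^d$ or $\le 0$ on all of $\mathbb{R}^d$. *)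

theory Defs
  imports
    "HOL-Analysis.Analysis"
    "HOL-Library.Poly_Mapping"
    "HOL-Computational_Algebra.Factorial_Ring"
begin

text \<open>
  The ring \<open>\<real>[z\<^sub>1,\<dots>,z\<^sub>d]\<close>, with the variables indexed by a finite type \<open>'n\<close>, so \<open>d = CARD('n)\<close>.
  A monomial is an exponent vector \<open>'n \<Rightarrow>\<^sub>0 nat\<close>, a polynomial is a finitely supported family
  of coefficients, and multiplication of poly-mappings is convolution, that is, the product of
  polynomials.
\<close>

type_synonym 'n real_mpoly = "('n \<Rightarrow>\<^sub>0 nat) \<Rightarrow>\<^sub>0 real"

definition eval_mpoly :: "'n::finite real_mpoly \<Rightarrow> real ^ 'n \<Rightarrow> real" where
  "eval_mpoly F x =
     (\<Sum>m\<in>Poly_Mapping.keys F. Poly_Mapping.lookup F m * (\<Prod>i\<in>UNIV. (x $ i) ^ Poly_Mapping.lookup m i))"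

definition constant_mpoly :: "'n::finite real_mpoly \<Rightarrow> bool" where
  "constant_mpoly F \<longleftrightarrow> (\<exists>c. F = Poly_Mapping.single 0 c)"

definition psd :: "'n::finite real_mpoly \<Rightarrow> bool" where
  "psd F \<longleftrightarrow> (\<forall>x. eval_mpoly F x \<ge> 0)"

definition sos :: "'n::finite real_mpoly \<Rightarrow> bool" where
  "sos F \<longleftrightarrow> (\<exists>(k::nat) (h :: nat \<Rightarrow> 'n real_mpoly). F = (\<Sum>i=1..k. (h i)\<^sup>2))"

definition artin_denominator :: "'n::finite real_mpoly \<Rightarrow> 'n real_mpoly \<Rightarrow> bool" where
  "artin_denominator F s \<longleftrightarrow> s \<noteq> 0 \<and> sos (s\<^sup>2 * F)"

text \<open>
  The quotient of \<open>s\<close> by an irreducible factor \<open>p\<close> is the (unique) \<open>q\<close> with \<open>s = p * q\<close>.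
\<close>

definition artin_minimal_denominator :: "'n::finite real_mpoly \<Rightarrow> 'n real_mpoly \<Rightarrow> bool" where
  "artin_minimal_denominator F s \<longleftrightarrow>
     artin_denominator F s \<and>
     (\<forall>p q. irreducible p \<and> s = p * q \<longrightarrow> \<not> artin_denominator F q)"

definition no_sign_change :: "'n::finite real_mpoly \<Rightarrow> bool" where
  "no_sign_change p \<longleftrightarrow> (\<forall>x. eval_mpoly p x \<ge> 0) \<or> (\<forall>x. eval_mpoly p x \<le> 0)"

end

theory Submission
  imports Defs "HOL-Algebra.Algebraic_Closure_Type"
begin

text \<open>
  An Artin denominator exists by Artin's solution of Hilbert's seventeenth problem, and one of least total degree is
  minimal. It is not constant, since \<open>F\<close> is not a sum of squares.

  For Artin's theorem, suppose that \<open>F\<close> is positive semidefinite without a denominator. Then the field of rational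
  functions remains formally real after adjoining \<open>\<surd>(-F)\<close>, and lies in a maximal formally real subfield \<open>R\<close> of
  an algebraic closure. This \<open>R\<close> is real closed, and in \<open>R\<close> the generic point \<open>(z\<^sub>1, \<dots>, z\<^sub>n)\<close> satisfies \<open>F < 0\<close>.
  The elimination method of Cohen and Hoermander shows that finitely many sign conditions that hold at a point over one real
  closed field can be transferred to another one, coordinate by coordinate, which yields a real point with \<open>F < 0\<close>.

  For the second claim, let \<open>p\<close> be an irreducible factor of the minimal denominator \<open>s\<close> that changes sign. In
  \<open>s\<^sup>2 F = \<Sum> h\<^sub>i\<^sup>2\<close> every \<open>h\<^sub>i\<close> vanishes on the zeros of \<open>p\<close>. If \<open>p\<close> did not divide \<open>h\<^sub>i\<close>, then the
  ideal \<open>(p, h\<^sub>i)\<close> would contain a nonzero polynomial \<open>r\<close> free of the variable \<open>z\<^sub>k\<close> along which \<open>p\<close> changes sign, and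
  \<open>r\<close> would vanish on an open set. So \<open>p\<close> divides all \<open>h\<^sub>i\<close>, and \<open>s / p\<close> is a denominator as well.
\<close>

text \<open>If \<open>1 + x - F y\<close> vanished for sums of squares \<open>x\<close>,
  \<open>y\<close> of rational functions, clearing denominators would produce a denominator of
  \<open>F\<close>; this is why the square root of \<open>- F\<close> can be adjoined. The function
  field is never ordered itself: in \<open>R\<close> every element or its negative is a square, so
  the squares alone determine an ordering. Real closedness enters only as the existence of roots at
  sign changes of polynomials; since suprema need not exist in \<open>R\<close>, Rolle and
  monotonicity are derived algebraically from it. The transfer handles one variable at a time. The
  finite set of polynomials whose signs must agree beforehand is computed without reference to the
  two points, which allows an induction over the variables. In the second claim \<open>r\<close>
  vanishes on an open set because every line in direction \<open>z_k\<close> near the sign change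
  meets a zero of \<open>p\<close>, and \<open>r\<close> is constant on that line. The elimination
  behind \<open>r\<close> and the primality of irreducible polynomials depend on each other and are
  proved in one induction over the variables.\<close>

section \<open>Real closed fields\<close>

hide_const (open) Divisibility.irreducible Divisibility.prime Polynomials.degree Polynomials.lead_coeff
  Coset.order up_ring.monom up_ring.coeff module.smult

text \<open>The constant \<open>poly\<close> is not applicable to the type of a class under definition, hence the explicit sums.\<close>

class real_closed_field = linordered_field +
  assumes sum_sign_change: "a < b \<Longrightarrow> (\<Sum>k\<le>n. f k * a ^ k) < 0 \<Longrightarrow> 0 < (\<Sum>k\<le>n. f k * b ^ k)
    \<Longrightarrow> \<exists>x. a < x \<and> x < b \<and> (\<Sum>k\<le>n. f k * x ^ k) = 0"

lemma poly_sum_monom: "poly (\<Sum>k\<le>n. monom (f k) k) (x :: 'a::comm_semiring_1) = (\<Sum>k\<le>n. f k * x ^ k)"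
  by (simp add: poly_sum poly_monom)

instance real :: real_closed_field
proof
  fix a b :: real and n and f :: "nat \<Rightarrow> real"
  assume "a < b" "(\<Sum>k\<le>n. f k * a ^ k) < 0" "0 < (\<Sum>k\<le>n. f k * b ^ k)"
  then show "\<exists>x. a < x \<and> x < b \<and> (\<Sum>k\<le>n. f k * x ^ k) = 0"
    using poly_IVT_pos[of a b "\<Sum>k\<le>n. monom (f k) k"] by (simp only: poly_sum_monom)
qed

lemma poly_sign_change:
  fixes p :: "'a::real_closed_field poly"
  assumes "a < b" "poly p a < 0" "0 < poly p b"
  shows "\<exists>x. a < x \<and> x < b \<and> poly p x = 0"
  using sum_sign_change[OF assms(1), of "coeff p" "degree p"] assms(2,3) by (simp add: poly_altdef)

text \<open>The two arguments live in different ordered rings, because signs over one real closed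
  field are compared with signs over another.\<close>

definition same_sign :: "'a::linordered_idom \<Rightarrow> 'b::linordered_idom \<Rightarrow> bool" where
  "same_sign x y \<longleftrightarrow> (0 < x \<longleftrightarrow> 0 < y) \<and> (x < 0 \<longleftrightarrow> y < 0)"

lemma same_sign_0_iff: "same_sign x y \<Longrightarrow> x = 0 \<longleftrightarrow> y = 0"
  unfolding same_sign_def by (metis less_irrefl not_less_iff_gr_or_eq)

lemma same_sign_sym: "same_sign x y \<Longrightarrow> same_sign y x"
  by (simp add: same_sign_def)

lemma same_sign_trans: "same_sign x y \<Longrightarrow> same_sign y z \<Longrightarrow> same_sign x z"
  by (simp add: same_sign_def)

lemma same_sign_mult: "same_sign x y \<Longrightarrow> same_sign x' y' \<Longrightarrow> same_sign (x * x') (y * y')"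
  unfolding same_sign_def zero_less_mult_iff mult_less_0_iff by blast

lemma same_sign_pos_mult_iff: "0 < c \<Longrightarrow> same_sign (c * x) y \<longleftrightarrow> same_sign x y"
  by (simp add: same_sign_def zero_less_mult_iff mult_less_0_iff)

section \<open>Rolle, the mean value theorem and monotonicity\<close>

lemma poly_sign_change':
  fixes p :: "'a::real_closed_field poly"
  assumes "a < b" "poly p a * poly p b < 0"
  shows "\<exists>x. a < x \<and> x < b \<and> poly p x = 0"
  using poly_sign_change[OF assms(1), of p] poly_sign_change[OF assms(1), of "- p"] assms(2)
  by (auto simp: mult_less_0_iff)

text \<open>With the factors at \<open>a\<close> and \<open>b\<close> split off, the cofactor
  \<open>q\<close> has equal signs at both ends, as otherwise it would have a root in between.
  Dividing \<open>pderiv p\<close> by \<open>[:-a,1:] ^ m * [:-b,1:] ^ n\<close> leaves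
  \<open>g\<close>, whose values at the ends carry the factors \<open>a - b\<close> and
  \<open>b - a\<close> and therefore have opposite signs.\<close>

lemma poly_rolle_adjacent:
  fixes p :: "'a::real_closed_field poly"
  assumes "a < b" "poly p a = 0" "poly p b = 0" "p \<noteq> 0"
    and noroot: "\<And>x. a < x \<Longrightarrow> x < b \<Longrightarrow> poly p x \<noteq> 0"
  shows "\<exists>z. a < z \<and> z < b \<and> poly (pderiv p) z = 0"
proof -
  obtain m where m: "order a p = Suc m"
    using assms by (metis not0_implies_Suc order_root)
  obtain r where r: "p = [:-a,1:] ^ Suc m * r" "\<not> [:-a,1:] dvd r"
    using order_decomp[OF \<open>p \<noteq> 0\<close>, of a] m by auto
  have "poly r b = 0" "r \<noteq> 0" using r assms by auto
  then obtain n where n: "order b r = Suc n"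
    by (metis not0_implies_Suc order_root)
  obtain q where q: "r = [:-b,1:] ^ Suc n * q" "\<not> [:-b,1:] dvd q"
    using order_decomp[OF \<open>r \<noteq> 0\<close>, of b] n by auto
  have qb: "poly q b \<noteq> 0" using q by (simp add: poly_eq_0_iff_dvd)
  have qa: "poly q a \<noteq> 0" using r q by (simp add: poly_eq_0_iff_dvd[symmetric])
  have qpos: "0 < poly q a * poly q b"
  proof (rule ccontr)
    assume "\<not> ?thesis"
    then have "poly q a * poly q b < 0" using qa qb by (simp add: not_less order.order_iff_strict)
    from poly_sign_change'[OF \<open>a < b\<close> this] show False using noroot r q by auto
  qed
  define g where "g = smult (of_nat (Suc m)) ([:-b,1:] * q) + smult (of_nat (Suc n)) ([:-a,1:] * q)
     + [:-a,1:] * [:-b,1:] * pderiv q"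
  have p': "pderiv p = [:-a,1:] ^ m * [:-b,1:] ^ n * g"
  proof -
    have "pderiv (u ^ Suc m * (v ^ Suc n * q)) = u ^ m * v ^ n *
        (smult (of_nat (Suc m)) (v * q) + smult (of_nat (Suc n)) (u * q) + u * v * pderiv q)"
      if "pderiv u = 1" "pderiv v = 1" for u v :: "'a poly"
      unfolding pderiv_mult pderiv_power_Suc that by (simp add: algebra_simps del: of_nat_Suc)
    from this[of "[:-a,1:]" "[:-b,1:]"] show ?thesis
      unfolding r(1) q(1) g_def by (simp add: pderiv_pCons)
  qed
  have ga: "poly g a = of_nat (Suc m) * (a - b) * poly q a" unfolding g_def by (simp add: algebra_simps)
  have gb: "poly g b = of_nat (Suc n) * (b - a) * poly q b" unfolding g_def by (simp add: algebra_simps)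
  have "poly g a * poly g b = - (of_nat (Suc m) * of_nat (Suc n) * (b - a)^2 * (poly q a * poly q b))"
    unfolding ga gb by (simp add: power2_eq_square algebra_simps)
  also have "\<dots> < 0" using qpos \<open>a < b\<close> by (simp add: add_pos_nonneg)
  finally obtain z where "a < z" "z < b" "poly g z = 0" using poly_sign_change'[OF \<open>a < b\<close>] by blast
  then show ?thesis using p' by auto
qed

lemma poly_rolle:
  fixes p :: "'a::real_closed_field poly"
  assumes "a < b" "poly p a = 0" "poly p b = 0"
  shows "\<exists>z. a < z \<and> z < b \<and> poly (pderiv p) z = 0"
proof (cases "p = 0")
  case True
  then show ?thesis using dense[OF \<open>a < b\<close>] by auto
next
  case False
  define S where "S = {x. poly p x = 0 \<and> a < x \<and> x \<le> b}"
  have fin: "finite S" unfolding S_def using poly_roots_finite[OF False] by simp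
  have "b \<in> S" using assms by (simp add: S_def)
  define c where "c = Min S"
  have c: "c \<in> S" unfolding c_def using fin \<open>b \<in> S\<close> by (intro Min_in) auto
  have "poly p x \<noteq> 0" if "a < x" "x < c" for x
  proof -
    have "x \<notin> S" using Min_le[OF fin, of x] that(2) by (auto simp: c_def)
    then show ?thesis using that c by (auto simp: S_def)
  qed
  from poly_rolle_adjacent[OF _ assms(2) _ False this] c show ?thesis
    unfolding S_def by force
qed

lemma poly_mvt:
  fixes p :: "'a::real_closed_field poly"
  assumes "a < b"
  shows "\<exists>z. a < z \<and> z < b \<and> poly p b - poly p a = (b - a) * poly (pderiv p) z"
proof -
  \<comment> \<open>The usual subtraction of the chord, multiplied by \<open>b - a\<close> to avoid
    the quotient.\<close>
  let ?q = "smult (b - a) (p - [:poly p a:]) - smult (poly p b - poly p a) [:-a, 1:]"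
  have "poly ?q a = 0" "poly ?q b = 0" by (simp_all add: algebra_simps)
  from poly_rolle[OF assms this] show ?thesis
    by (auto simp: pderiv_diff pderiv_smult pderiv_pCons pderiv_add)
qed

lemma poly_less_of_pderiv_pos:
  fixes p :: "'a::real_closed_field poly"
  assumes "a < b" "\<And>x. a < x \<Longrightarrow> x < b \<Longrightarrow> 0 < poly (pderiv p) x"
  shows "poly p a < poly p b"
proof -
  obtain z where "a < z" "z < b" "poly p b - poly p a = (b - a) * poly (pderiv p) z"
    using poly_mvt[OF assms(1)] by blast
  with assms have "0 < poly p b - poly p a" by simp
  then show ?thesis by simp
qed

text \<open>A uniform bound \<open>e\<close>, unlike plain positivity, survives the induction: once
  \<open>x\<close> exceeds \<open>(1 - c) / e\<close>, the product \<open>x * poly p x\<close>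
  outweighs the new constant term \<open>c\<close>.\<close>

lemma poly_eventually_ge_pos:
  fixes p :: "'a::linordered_field poly"
  assumes "0 < lead_coeff p"
  shows "\<exists>e>0. eventually (\<lambda>x. e \<le> poly p x) at_top"
  using assms
proof (induction p)
  case (pCons c p)
  show ?case
  proof (cases "p = 0")
    case True
    then show ?thesis using pCons by (auto intro!: exI[of _ c])
  next
    case False
    then obtain e where e: "e > 0" "eventually (\<lambda>x. e \<le> poly p x) at_top" using pCons by auto
    have "eventually (\<lambda>x. 1 \<le> poly (pCons c p) x) at_top"
      using e(2) eventually_ge_at_top[of "(1 - c) / e"] eventually_ge_at_top[of 0]
    proof eventually_elim
      case (elim x)
      have "1 - c \<le> x * e" using elim e(1) by (simp add: field_simps)
      also have "\<dots> \<le> x * poly p x" using elim by (intro mult_left_mono) auto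
      finally show ?case by (simp add: algebra_simps)
    qed
    then show ?thesis by (intro exI[of _ 1]) auto
  qed
qed auto

lemma poly_eventually_same_sign:
  fixes p :: "'a::linordered_field poly"
  shows "eventually (\<lambda>x. same_sign (poly p x) (lead_coeff p)) at_top"
proof -
  consider "p = 0" | "0 < lead_coeff p" | "0 < lead_coeff (- p)"
    by (metis leading_coeff_0_iff lead_coeff_minus neg_0_less_iff_less linorder_neqE)
  then show ?thesis
  proof cases
    case 2
    obtain e where "e > 0" "eventually (\<lambda>x. e \<le> poly p x) at_top" using poly_eventually_ge_pos[OF 2] by blast
    then show ?thesis using 2 by (auto elim!: eventually_mono simp: same_sign_def)
  next
    case 3
    obtain e where "e > 0" "eventually (\<lambda>x. e \<le> poly (-p) x) at_top" using poly_eventually_ge_pos[OF 3] by blast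
    then show ?thesis using 3 by (auto elim!: eventually_mono simp: same_sign_def)
  qed (simp add: same_sign_def)
qed

lemma poly_uminus_eventually_same_sign:
  fixes p :: "'a::linordered_field poly"
  shows "eventually (\<lambda>x. same_sign (poly p (- x)) ((-1) ^ degree p * lead_coeff p)) at_top"
  using poly_eventually_same_sign[of "pcompose p [:0, -1:]"]
  by (simp add: poly_pcompose lead_coeff_comp mult.commute)

text \<open>The point \<open>t\<close> is enclosed in a shrinking interval, and a companion interval in \<open>'b\<close> is kept on which
  the treated polynomials have the same signs. A polynomial \<open>p\<close> of least degree among the untreated ones
  is strictly monotone on the interval, as its derivative has already been treated. At a root of \<open>p\<close> every
  untreated polynomial has the sign of its remainder modulo \<open>p\<close>, so that signs at end points agree.\<close>

lemma sign_matching: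
  fixes P :: "('a::real_closed_field poly \<times> 'b::real_closed_field poly) set" and t :: 'a
  assumes fin: "finite P"
    and deg: "\<And>p q. (p, q) \<in> P \<Longrightarrow> degree p = degree q"
    and lead: "\<And>p q. (p, q) \<in> P \<Longrightarrow> same_sign (lead_coeff p) (lead_coeff q)"
    and der: "\<And>p q. (p, q) \<in> P \<Longrightarrow> 0 < degree p \<Longrightarrow> (pderiv p, pderiv q) \<in> P"
    and rem: "\<And>p q p' q'. (p, q) \<in> P \<Longrightarrow> (p', q') \<in> P \<Longrightarrow> 0 < degree p \<Longrightarrow> degree p \<le> degree p' \<Longrightarrow>
      \<exists>r s c d g h. (r, s) \<in> P \<and> degree r < degree p \<and> 0 < c \<and> 0 < d \<and>
        smult c p' = p * g + r \<and> smult d q' = q * h + s"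
  shows "\<exists>u. \<forall>(p, q)\<in>P. same_sign (poly p t) (poly q u)"
proof -
  define agree where "agree x y \<longleftrightarrow> (\<forall>(p, q)\<in>P. same_sign (poly p x) (poly q y))" for x y
  \<comment> \<open>The end points agree on all of \<open>P\<close>, the interior only on the
    treated part \<open>S\<close>.\<close>
  define enclosed where "enclosed S \<longleftrightarrow> (\<exists>a b a' b'. a < t \<and> t < b \<and> a' < b' \<and> agree a a' \<and> agree b b' \<and>
     (\<forall>(p, q)\<in>S. \<forall>x y. a < x \<and> x < b \<and> a' < y \<and> y < b' \<longrightarrow> same_sign (poly p x) (poly q y)))" for S
  \<comment> \<open>Far out the signs are those of the leading coefficients, on the left corrected
    by the parity of the degree.\<close>
  have base: "enclosed {}"
  proof -
    have ev: "eventually (\<lambda>x. \<forall>(p, q)\<in>P. same_sign (poly p x) (lead_coeff p) \<and>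
       same_sign (poly p (- x)) ((-1) ^ degree p * lead_coeff p)) at_top"
      by (intro eventually_ball_finite fin ballI)
        (auto intro!: eventually_conj poly_eventually_same_sign poly_uminus_eventually_same_sign)
    have ev': "eventually (\<lambda>x. \<forall>(p, q)\<in>P. same_sign (poly q x) (lead_coeff q) \<and>
       same_sign (poly q (- x)) ((-1) ^ degree q * lead_coeff q)) at_top"
      by (intro eventually_ball_finite fin ballI)
        (auto intro!: eventually_conj poly_eventually_same_sign poly_uminus_eventually_same_sign)
    obtain M where M: "t < M" "- t < M" "\<forall>(p, q)\<in>P. same_sign (poly p M) (lead_coeff p) \<and>
       same_sign (poly p (- M)) ((-1) ^ degree p * lead_coeff p)"
      using eventually_happens[OF eventually_conj[OF ev eventually_conj[OF
            eventually_gt_at_top[of t] eventually_gt_at_top[of "- t"]]]] by auto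
    obtain N where N: "0 < N" "\<forall>(p, q)\<in>P. same_sign (poly q N) (lead_coeff q) \<and>
       same_sign (poly q (- N)) ((-1) ^ degree q * lead_coeff q)"
      using eventually_happens[OF eventually_conj[OF ev' eventually_gt_at_top[of 0]]] by auto
    have "same_sign ((-1) ^ degree p * lead_coeff p) ((-1) ^ degree q * lead_coeff q)" if "(p, q) \<in> P" for p q
      using lead[OF that] by (intro same_sign_mult) (simp_all add: deg[OF that] same_sign_def minus_one_power_iff)
    note ** = this
    have "same_sign (poly p (- M)) (poly q (- N)) \<and> same_sign (poly p M) (poly q N)" if pq: "(p, q) \<in> P" for p q
    proof -
      have 1: "same_sign (poly p M) (lead_coeff p)" "same_sign (poly p (- M)) ((-1) ^ degree p * lead_coeff p)"
        using M(3) pq by auto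
      have 2: "same_sign (poly q N) (lead_coeff q)" "same_sign (poly q (- N)) ((-1) ^ degree q * lead_coeff q)"
        using N(2) pq by auto
      show ?thesis
        using same_sign_trans[OF same_sign_trans[OF 1(1) lead[OF pq]] same_sign_sym[OF 2(1)]]
          same_sign_trans[OF same_sign_trans[OF 1(2) **[OF pq]] same_sign_sym[OF 2(2)]] by simp
    qed
    then have "agree (- M) (- N)" "agree M N"
      unfolding agree_def by blast+
    then show ?thesis
      unfolding enclosed_def using M N by (intro exI[of _ "- M"] exI[of _ M] exI[of _ "- N"] exI[of _ N]) auto
  qed
  \<comment> \<open>The second alternative arises when \<open>t\<close> is itself a root of
    \<open>p\<close>; the matching point is then found at once.\<close>
  have step: "enclosed (insert (p, q) S) \<or> (\<exists>u. agree t u)"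
    if S: "S \<subseteq> P" "enclosed S" "(p, q) \<in> P"
      and low: "\<And>p' q'. (p', q') \<in> P \<Longrightarrow> degree p' < degree p \<Longrightarrow> (p', q') \<in> S"
      and high: "\<And>p' q'. (p', q') \<in> P \<Longrightarrow> (p', q') \<notin> S \<Longrightarrow> degree p \<le> degree p'"
    for S p q
  proof (cases "degree p = 0")
    case True
    then have "degree q = 0" using deg S by auto
    with True obtain c d where "p = [:c:]" "q = [:d:]" by (metis degree_eq_zeroE)
    then show ?thesis using S lead[OF S(3)] unfolding enclosed_def by (fastforce split: prod.splits)
  next
    case False
    obtain a b a' b' where ab: "a < t" "t < b" "a' < b'" "agree a a'" "agree b b'"
      and sgn: "\<And>p q x y. (p, q) \<in> S \<Longrightarrow> a < x \<Longrightarrow> x < b \<Longrightarrow> a' < y \<Longrightarrow> y < b' \<Longrightarrow> same_sign (poly p x) (poly q y)"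
      using S(2) unfolding enclosed_def by blast
    have "a < b" using ab by simp
    have "degree (pderiv p) < degree p" using False by (simp add: degree_pderiv)
    then have der_S: "(pderiv p, pderiv q) \<in> S" using der[OF S(3)] False low by auto
    have "pderiv p \<noteq> 0" using False by (simp add: pderiv_eq_0_iff)
    then have "finite {x. poly (pderiv p) x = 0}" by (rule poly_roots_finite)
    then obtain x0 where x0: "a < x0" "x0 < b" "poly (pderiv p) x0 \<noteq> 0"
      using infinite_Ioo[OF \<open>a < b\<close>] by (metis (mono_tags, lifting) finite_subset greaterThanLessThan_iff mem_Collect_eq subsetI)
    obtain y0 where y0: "a' < y0" "y0 < b'" using dense[OF ab(3)] by blast
    have der_sgn: "same_sign (poly (pderiv p) x) (poly (pderiv p) x0)"
      "same_sign (poly (pderiv p) x0) (poly (pderiv q) y)"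
      if "a < x" "x < b" "a' < y" "y < b'" for x y
      using sgn[OF der_S] that x0 y0 by (blast intro: same_sign_trans same_sign_sym)+
    \<comment> \<open>The common sign of both derivatives: multiplied by it, \<open>p\<close> and
      \<open>q\<close> both become increasing.\<close>
    obtain e :: 'a and e' :: 'b where e: "same_sign e e'" "e \<noteq> 0" "same_sign e (poly (pderiv p) x0)"
    proof (cases "0 < poly (pderiv p) x0")
      case True
      then show thesis by (intro that[of 1 1]) (auto simp: same_sign_def)
    next
      case False
      then have "poly (pderiv p) x0 < 0" using x0(3) by simp
      then show thesis by (intro that[of "-1" "-1"]) (auto simp: same_sign_def)
    qed
    have e0: "0 < e * poly (pderiv p) x0"
      using e(2,3) by (auto simp: same_sign_def zero_less_mult_iff neq_iff)
    let ?f = "\<lambda>x. e * poly p x" and ?g = "\<lambda>y. e' * poly q y"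
    have fg: "same_sign (poly p x) (poly q y) \<longleftrightarrow> same_sign (?f x) (?g y)" for x y
    proof (cases "0 < e")
      case True
      then have "0 < e'" using e(1) by (simp add: same_sign_def)
      with True show ?thesis by (simp add: same_sign_def zero_less_mult_iff mult_less_0_iff)
    next
      case False
      then have "e < 0" using e(2) by simp
      then have "e' < 0" using e(1) by (simp add: same_sign_def)
      with \<open>e < 0\<close> show ?thesis by (auto simp add: same_sign_def zero_less_mult_iff mult_less_0_iff)
    qed
    have f_mono: "?f x < ?f y" if "a \<le> x" "x < y" "y \<le> b" for x y
    proof -
      have "poly (smult e p) x < poly (smult e p) y"
        using that e0 der_sgn(1)[OF _ _ y0] 
        by (intro poly_less_of_pderiv_pos) (auto simp: pderiv_smult same_sign_def zero_less_mult_iff)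
      then show ?thesis by simp
    qed
    have g_mono: "?g x < ?g y" if "a' \<le> x" "x < y" "y \<le> b'" for x y
    proof -
      have "poly (smult e' q) x < poly (smult e' q) y"
        using that e e0 der_sgn(2)[OF x0(1,2)]
        by (intro poly_less_of_pderiv_pos) (auto simp: pderiv_smult same_sign_def zero_less_mult_iff)
      then show ?thesis by simp
    qed
    have ends: "same_sign (?f a) (?g a')" "same_sign (?f b) (?g b')"
      using ab(4,5) S(3) unfolding agree_def fg[symmetric] by auto
    consider "0 \<le> ?f a" | "?f b \<le> 0" | "?f a < 0" "0 < ?f b" by linarith
    then show ?thesis
    proof cases
      case 1
      then have "0 \<le> ?g a'" using ends by (auto simp: same_sign_def not_less[symmetric])
      have "same_sign (poly p x) (poly q y)" if "a < x" "x < b" "a' < y" "y < b'" for x y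
      proof -
        have "0 < ?f x" "0 < ?g y"
          using f_mono[of a x] g_mono[of a' y] that 1 \<open>0 \<le> ?g a'\<close> by auto
        then show ?thesis unfolding fg by (auto simp: same_sign_def)
      qed
      then have "enclosed (insert (p, q) S)"
        unfolding enclosed_def using ab sgn by (intro exI[of _ a] exI[of _ b] exI[of _ a'] exI[of _ b']) auto
      then show ?thesis ..
    next
      case 2
      then have "?g b' \<le> 0" using ends by (auto simp: same_sign_def not_less[symmetric])
      have "same_sign (poly p x) (poly q y)" if "a < x" "x < b" "a' < y" "y < b'" for x y
      proof -
        have "?f x < 0" "?g y < 0"
          using f_mono[of x b] g_mono[of y b'] that 2 \<open>?g b' \<le> 0\<close> by auto
        then show ?thesis unfolding fg by (auto simp: same_sign_def)
      qed
      then have "enclosed (insert (p, q) S)"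
        unfolding enclosed_def using ab sgn by (intro exI[of _ a] exI[of _ b] exI[of _ a'] exI[of _ b']) auto
      then show ?thesis ..
    next
      case 3
      obtain z where z: "a < z" "z < b" "poly p z = 0"
        using poly_sign_change[of a b "smult e p"] 3 \<open>a < b\<close> e(2) by auto
      have "?g a' < 0" "0 < ?g b'" using 3 ends by (auto simp: same_sign_def)
      then obtain z' where z': "a' < z'" "z' < b'" "poly q z' = 0"
        using poly_sign_change[of a' b' "smult e' q"] ab(3) by auto
      have agree_z: "agree z z'"
        unfolding agree_def
      proof safe
        fix p1 q1 assume pq1: "(p1, q1) \<in> P"
        show "same_sign (poly p1 z) (poly q1 z')"
        proof (cases "(p1, q1) \<in> S")
          case True
          then show ?thesis using sgn z z' by blast
        next
          case F: False
          obtain r s c d g h where r: "(r, s) \<in> P" "degree r < degree p" "0 < c" "0 < d"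
            "smult c p1 = p * g + r" "smult d q1 = q * h + s"
            using rem[OF S(3) pq1] high[OF pq1 F] False by auto
          have "same_sign (poly r z) (poly s z')" using sgn low r z z' by blast
          moreover have "c * poly p1 z = poly r z" "d * poly q1 z' = poly s z'"
            using arg_cong[OF r(5), of "\<lambda>f. poly f z"] arg_cong[OF r(6), of "\<lambda>f. poly f z'"] z z' by auto
          ultimately show ?thesis using r(3,4)
            by (metis same_sign_pos_mult_iff same_sign_sym)
        qed
      qed
      \<comment> \<open>Unless \<open>t\<close> is the root, the part of the interval containing
        \<open>t\<close> is kept, with \<open>z\<close> and \<open>z'\<close> as new matching end
        points.\<close>
      consider "t = z" | "t < z" | "z < t" by fastforce
      then show ?thesis
      proof cases
        case 1
        then show ?thesis using agree_z by blast
      next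
        case 2
        have "same_sign (poly p x) (poly q y)" if "a < x" "x < z" "a' < y" "y < z'" for x y
        proof -
          have "?f x < 0" "?g y < 0"
            using f_mono[of x z] g_mono[of y z'] that z z' by auto
          then show ?thesis unfolding fg by (auto simp: same_sign_def)
        qed
        then have "enclosed (insert (p, q) S)"
          unfolding enclosed_def using ab sgn agree_z z z' 2
          by (intro exI[of _ a] exI[of _ z] exI[of _ a'] exI[of _ z']) (auto intro: less_trans)
        then show ?thesis ..
      next
        case 3
        have "same_sign (poly p x) (poly q y)" if "z < x" "x < b" "z' < y" "y < b'" for x y
        proof -
          have "0 < ?f x" "0 < ?g y"
            using f_mono[of z x] g_mono[of z' y] that z z' by auto
          then show ?thesis unfolding fg by (auto simp: same_sign_def)
        qed
        then have "enclosed (insert (p, q) S)"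
          unfolding enclosed_def using ab sgn agree_z z z' 3
          by (intro exI[of _ z] exI[of _ b] exI[of _ z'] exI[of _ b']) (auto intro: less_trans)
        then show ?thesis ..
      qed
    qed
  qed
  \<comment> \<open>The polynomials are treated in order of increasing degree; at
    \<open>k = card P\<close> none is left.\<close>
  have "\<exists>S\<subseteq>P. card S = k \<and> (enclosed S \<or> (\<exists>u. agree t u)) \<and>
     (\<forall>x\<in>S. \<forall>y\<in>P - S. degree (fst x) \<le> degree (fst y))" if "k \<le> card P" for k
    using that
  proof (induction k)
    case 0
    then show ?case using base by (intro exI[of _ "{}"]) auto
  next
    case (Suc k)
    then obtain S where S: "S \<subseteq> P" "card S = k" "enclosed S \<or> (\<exists>u. agree t u)"
      "\<forall>x\<in>S. \<forall>y\<in>P - S. degree (fst x) \<le> degree (fst y)" by auto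
    have "finite S" using S fin finite_subset by blast
    have "P - S \<noteq> {}" using S Suc.prems fin by (metis Diff_eq_empty_iff card_mono not_less_eq_eq finite_subset)
    then obtain pq where pq: "pq \<in> P - S" "\<forall>y\<in>P - S. degree (fst pq) \<le> degree (fst y)"
      using ex_has_least_nat[of "\<lambda>y. y \<in> P - S" _ "\<lambda>y. degree (fst y)"] by blast
    obtain p q where pq': "pq = (p, q)" by force
    have "enclosed (insert (p, q) S) \<or> (\<exists>u. agree t u)"
      using S(3)
    proof
      assume "enclosed S"
      then show ?thesis
        by (rule step[OF S(1)]) (use pq pq' in force)+
    qed auto
    moreover have "card (insert (p, q) S) = Suc k" using pq pq' \<open>finite S\<close> S by auto
    moreover have "\<forall>x\<in>insert (p, q) S. \<forall>y\<in>P - insert (p, q) S. degree (fst x) \<le> degree (fst y)"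
      using S(4) pq pq' by auto
    ultimately show ?case using S pq pq' by (intro exI[of _ "insert (p, q) S"]) auto
  qed
  from this[of "card P"] have "enclosed P \<or> (\<exists>u. agree t u)"
    using fin by (metis card_subset_eq order_refl)
  then show ?thesis
  proof
    assume "enclosed P"
    then obtain a b a' b' where *: "a < t" "t < b" "a' < b'"
      "\<forall>(p, q)\<in>P. \<forall>x y. a < x \<and> x < b \<and> a' < y \<and> y < b' \<longrightarrow> same_sign (poly p x) (poly q y)"
      unfolding enclosed_def by blast
    obtain u where "a' < u" "u < b'" using dense[OF *(3)] by blast
    then show ?thesis using * by blast
  qed (simp add: agree_def)
qed

section \<open>Transfer of sign conditions between real closed fields\<close>

locale comm_ring_hom =
  fixes h :: "'a::comm_ring_1 \<Rightarrow> 'b::comm_ring_1"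
  assumes hom_one: "h 1 = 1" and hom_add: "h (x + y) = h x + h y" and hom_mult: "h (x * y) = h x * h y"
begin

lemma hom_zero [simp]: "h 0 = 0"
  using hom_add[of 0 0] by simp

lemma hom_uminus: "h (- x) = - h x"
  using hom_add[of x "- x"] by (simp add: eq_neg_iff_add_eq_0 add.commute)

lemma hom_diff: "h (x - y) = h x - h y"
  using hom_add[of x "- y"] by (simp add: hom_uminus)

lemma hom_power: "h (x ^ n) = h x ^ n"
  by (induction n) (simp_all add: hom_one hom_mult)

lemma hom_of_nat: "h (of_nat n) = of_nat n"
  by (induction n) (simp_all add: hom_one hom_add)

lemma map_poly_hom_add: "map_poly h (p + q) = map_poly h p + map_poly h q"
  by (rule poly_eqI) (simp add: coeff_map_poly hom_add)

lemma map_poly_hom_smult: "map_poly h (smult c p) = smult (h c) (map_poly h p)"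
  by (rule poly_eqI) (simp add: coeff_map_poly hom_mult)

lemma map_poly_hom_mult: "map_poly h (p * q) = map_poly h p * map_poly h q"
  by (induction p) (simp_all add: map_poly_hom_add map_poly_hom_smult map_poly_pCons)

lemma degree_map_poly_hom_le: "degree (map_poly h p) \<le> degree p"
  by (rule degree_le) (simp add: coeff_map_poly coeff_eq_0)

lemma poly_map_poly_hom: "poly (map_poly h p) (h x) = h (poly p x)"
  by (induction p) (simp_all add: map_poly_pCons hom_add hom_mult)

end

lemma map_poly_hom_pderiv:
  fixes h :: "'a::idom \<Rightarrow> 'b::idom"
  assumes "comm_ring_hom h"
  shows "map_poly h (pderiv p) = pderiv (map_poly h p)"
proof -
  interpret comm_ring_hom h by fact
  show ?thesis
    by (rule poly_eqI) (simp add: coeff_map_poly coeff_pderiv hom_mult hom_add hom_one hom_of_nat)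
qed

lemma comm_ring_hom_comp:
  assumes "comm_ring_hom f" "comm_ring_hom g"
  shows "comm_ring_hom (\<lambda>x. f (g x))"
  using assms by (simp add: comm_ring_hom_def)

definition subring_set :: "'a::comm_ring_1 set \<Rightarrow> bool" where
  "subring_set S \<longleftrightarrow> 1 \<in> S \<and> (\<forall>x\<in>S. \<forall>y\<in>S. x - y \<in> S \<and> x * y \<in> S)"

context
  fixes S :: "'a::comm_ring_1 set"
  assumes S: "subring_set S"
begin

lemma subring_one: "1 \<in> S"
  and subring_diff: "x \<in> S \<Longrightarrow> y \<in> S \<Longrightarrow> x - y \<in> S"
  and subring_mult: "x \<in> S \<Longrightarrow> y \<in> S \<Longrightarrow> x * y \<in> S"
  using S by (auto simp: subring_set_def)

lemma subring_zero: "0 \<in> S"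
  using subring_diff[OF subring_one subring_one] by simp

lemma subring_uminus: "x \<in> S \<Longrightarrow> - x \<in> S"
  using subring_diff[OF subring_zero] by fastforce

lemma subring_add: "x \<in> S \<Longrightarrow> y \<in> S \<Longrightarrow> x + y \<in> S"
  using subring_diff[OF _ subring_uminus] by fastforce

lemma subring_power: "x \<in> S \<Longrightarrow> x ^ n \<in> S"
  by (induction n) (auto intro: subring_one subring_mult)

lemma subring_sum: "(\<And>x. x \<in> A \<Longrightarrow> f x \<in> S) \<Longrightarrow> sum f A \<in> S"
  by (induction A rule: infinite_finite_induct) (auto intro: subring_zero subring_add)

lemma subring_prod: "(\<And>x. x \<in> A \<Longrightarrow> f x \<in> S) \<Longrightarrow> prod f A \<in> S"
  by (induction A rule: infinite_finite_induct) (auto intro: subring_one subring_mult)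

lemma subring_of_nat: "of_nat n \<in> S"
  by (induction n) (auto intro: subring_zero subring_one subring_add)

lemma subring_set_polys: "subring_set {p. \<forall>i. coeff p i \<in> S}"
  unfolding subring_set_def
  by (auto simp: coeff_mult coeff_pCons one_pCons split: nat.splits
      intro: subring_zero subring_one subring_diff subring_sum subring_mult)

text \<open>Each step multiplies \<open>f\<close> by the leading coefficient of \<open>g\<close> and
  cancels the top term, so no division takes place in \<open>S\<close>. The case
  \<open>r = 0\<close> is listed because \<open>g\<close> may be constant.\<close>

lemma pseudo_division:
  assumes "\<And>i. coeff f i \<in> S" "\<And>i. coeff g i \<in> S" "g \<noteq> 0"
  shows "\<exists>m h r. smult (lead_coeff g ^ m) f = g * h + r \<and> (r = 0 \<or> degree r < degree g) \<and>
    (\<forall>i. coeff h i \<in> S) \<and> (\<forall>i. coeff r i \<in> S)"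
  using assms(1)
proof (induction "degree f" arbitrary: f rule: less_induct)
  case less
  note T = subring_set_polys
  show ?case
  proof (cases "f = 0 \<or> degree f < degree g")
    case True
    then show ?thesis using less.prems by (intro exI[of _ 0] exI[of _ f]) (auto simp: subring_zero)
  next
    case False
    define k where "k = monom (lead_coeff f) (degree f - degree g)"
    define f1 where "f1 = smult (lead_coeff g) f - k * g"
    have kS: "\<forall>i. coeff k i \<in> S" using less.prems by (simp add: k_def subring_zero)
    have f1S: "\<And>i. coeff f1 i \<in> S"
      using subring_mult[of "coeff k _" "coeff g _"] kS assms(2) less.prems
      unfolding f1_def coeff_diff coeff_smult coeff_mult
      by (intro subring_diff subring_mult subring_sum) auto
    have deg: "f1 = 0 \<or> degree f1 < degree f"
    proof -
      have "coeff f1 i = 0" if "i \<ge> degree f" for i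
      proof (cases "i = degree f")
        case True
        then show ?thesis using False
          by (simp add: f1_def k_def coeff_monom_mult)
      next
        case False
        with that have "i > degree f" by simp
        moreover from this \<open>\<not> (f = 0 \<or> degree f < degree g)\<close>
        have "degree g < i - (degree f - degree g)" by linarith
        ultimately show ?thesis by (simp add: f1_def k_def coeff_monom_mult coeff_eq_0)
      qed
      then show ?thesis by (metis leading_coeff_0_iff not_less)
    qed
    show ?thesis
    proof (cases "f1 = 0")
      case True
      then have "smult (lead_coeff g ^ 1) f = g * k + 0" by (simp add: f1_def mult.commute)
      then show ?thesis using kS subring_zero by (intro exI[of _ 1] exI[of _ k] exI[of _ 0]) auto
    next
      case False
      then obtain m h r where *: "smult (lead_coeff g ^ m) f1 = g * h + r" "r = 0 \<or> degree r < degree g"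
        "\<forall>i. coeff h i \<in> S" "\<forall>i. coeff r i \<in> S"
        using less.hyps[OF _ f1S] deg by auto
      have "smult (lead_coeff g ^ Suc m) f = smult (lead_coeff g ^ m) (f1 + k * g)"
        by (simp add: f1_def mult.commute)
      also have "\<dots> = g * (h + smult (lead_coeff g ^ m) k) + r"
        using *(1) by (simp add: smult_add_right algebra_simps)
      finally show ?thesis using * kS assms(2)
        by (intro exI[of _ "Suc m"] exI[of _ "h + smult (lead_coeff g ^ m) k"] exI[of _ r])
          (auto intro!: subring_add subring_mult subring_power)
    qed
  qed
qed

end

text \<open>A homomorphism may kill the leading coefficient of \<open>f\<close>; then
  \<open>f\<close> and \<open>truncate f\<close> have the same image.\<close>

definition truncate :: "'a::comm_ring_1 poly \<Rightarrow> 'a poly" where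
  "truncate f = f - monom (lead_coeff f) (degree f)"

lemma degree_truncate: "0 < degree f \<Longrightarrow> degree (truncate f) < degree f"
proof -
  assume "0 < degree f"
  have "coeff (truncate f) i = 0" if "i \<ge> degree f" for i
    using that by (cases "i = degree f") (auto simp: truncate_def coeff_eq_0)
  then show ?thesis using \<open>0 < degree f\<close>
    by (metis degree_0 leading_coeff_0_iff not_less)
qed

text \<open>The even exponent makes the multiplier positive in every ordered image where the leading
  coefficient does not vanish, so signs are preserved.\<close>

definition pseudo_remainder :: "'a::comm_ring_1 poly \<Rightarrow> 'a poly \<Rightarrow> 'a poly \<Rightarrow> bool" where
  "pseudo_remainder f g r \<longleftrightarrow> degree r < degree g \<and> (\<exists>m h. smult (lead_coeff g ^ (2 * m)) f = g * h + r)"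

text \<open>Closing from the top degree downwards terminates: the derivatives, truncations and
  pseudo-remainders that the polynomials of degree \<open>Suc n\<close> call for have smaller
  degree. So no further polynomial of degree \<open>Suc n\<close> or more ever appears, and the
  induction hypothesis closes the rest.\<close>

lemma finite_closure:
  fixes F :: "'a::idom poly set"
  assumes "subring_set S" "finite F" "\<And>f i. f \<in> F \<Longrightarrow> coeff f i \<in> S"
  shows "\<exists>G. F \<subseteq> G \<and> finite G \<and> (\<forall>f\<in>G. \<forall>i. coeff f i \<in> S) \<and> (\<forall>f\<in>G - F. degree f < n) \<and>
    (\<forall>f\<in>G. 0 < degree f \<longrightarrow> degree f \<le> n \<longrightarrow> pderiv f \<in> G \<and> truncate f \<in> G) \<and>
    (\<forall>f\<in>G. \<forall>g\<in>G. 0 < degree g \<longrightarrow> degree g \<le> n \<longrightarrow> degree g \<le> degree f \<longrightarrow>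
      (\<exists>r\<in>G. pseudo_remainder f g r))"
  using assms(2,3)
proof (induction n arbitrary: F)
  case 0
  then show ?case by (intro exI[of _ F]) auto
next
  case (Suc n)
  note S = assms(1)
  have "\<exists>r. pseudo_remainder f g r \<and> (\<forall>i. coeff r i \<in> S)" if fg: "f \<in> F" "g \<in> F" "0 < degree g" for f g
  proof -
    have "\<exists>m h r. smult (lead_coeff g ^ m) f = g * h + r \<and> (r = 0 \<or> degree r < degree g) \<and>
      (\<forall>i. coeff h i \<in> S) \<and> (\<forall>i. coeff r i \<in> S)"
      by (rule pseudo_division[OF S]) (use Suc.prems(2) fg in auto)
    then obtain m h r where *: "smult (lead_coeff g ^ m) f = g * h + r" "r = 0 \<or> degree r < degree g"
      "\<forall>i. coeff r i \<in> S" by blast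
    let ?c = "lead_coeff g ^ m"
    have "smult (lead_coeff g ^ (2 * m)) f = smult ?c (smult ?c f)"
      by (simp add: mult_2 power_add)
    also have "\<dots> = g * smult ?c h + smult ?c r" unfolding *(1) by (simp add: smult_add_right)
    finally have "pseudo_remainder f g (smult ?c r)"
      using *(2) fg(3) le_less_trans[OF degree_smult_le] unfolding pseudo_remainder_def by fastforce
    moreover have "\<forall>i. coeff (smult ?c r) i \<in> S"
      using * Suc.prems(2)[OF fg(2)] by (auto intro!: subring_mult[OF S] subring_power[OF S])
    ultimately show ?thesis by blast
  qed
  then obtain R where R: "\<And>f g. f \<in> F \<Longrightarrow> g \<in> F \<Longrightarrow> 0 < degree g \<Longrightarrow>
      pseudo_remainder f g (R f g) \<and> (\<forall>i. coeff (R f g) i \<in> S)" by metis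
  define H where "H = {f \<in> F. degree f = Suc n}"
  define F1 where "F1 = F \<union> pderiv ` H \<union> truncate ` H \<union> (\<lambda>(f, g). R f g) ` (F \<times> H)"
  have HF: "H \<subseteq> F" "\<And>f. f \<in> H \<Longrightarrow> degree f = Suc n" by (auto simp: H_def)
  have fin: "finite F1" unfolding F1_def using Suc.prems HF(1) by (auto intro: finite_subset)
  have "coeff f i \<in> S" if "f \<in> F1" for f i
    using that Suc.prems(2) R HF
    by (auto simp: F1_def truncate_def coeff_pderiv simp del: of_nat_Suc
        intro!: subring_mult[OF S] subring_diff[OF S] subring_of_nat[OF S] subring_zero[OF S])
      (fastforce simp: subset_iff)+
  from Suc.IH[OF fin this] obtain G where G: "F1 \<subseteq> G" "finite G" "\<forall>f\<in>G. \<forall>i. coeff f i \<in> S"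
    "\<forall>f\<in>G - F1. degree f < n"
    "\<forall>f\<in>G. 0 < degree f \<longrightarrow> degree f \<le> n \<longrightarrow> pderiv f \<in> G \<and> truncate f \<in> G"
    "\<forall>f\<in>G. \<forall>g\<in>G. 0 < degree g \<longrightarrow> degree g \<le> n \<longrightarrow> degree g \<le> degree f \<longrightarrow> (\<exists>r\<in>G. pseudo_remainder f g r)"
    by blast
  have new: "degree f < Suc n" if "f \<in> F1 - F" for f
  proof -
    have "degree (pderiv x) < Suc n" "degree (truncate x) < Suc n" if "x \<in> H" for x
    proof -
      have "degree (pderiv x) \<le> degree x - 1"
        by (rule degree_le) (auto simp: coeff_pderiv coeff_eq_0)
      then show "degree (pderiv x) < Suc n" "degree (truncate x) < Suc n"
        using HF(2)[OF that] degree_truncate[of x] by auto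
    qed
    moreover have "degree (R x y) < Suc n" if "x \<in> F" "y \<in> H" for x y
      using R[of x y] that HF by (auto simp: pseudo_remainder_def)
    ultimately show ?thesis using that by (auto simp: F1_def)
  qed
  have old: "f \<in> F" if "f \<in> G" "Suc n \<le> degree f" for f
    using that new[of f] G(4) by force
  show ?case
  proof (intro exI[of _ G] conjI ballI impI)
    show "F \<subseteq> G" using G(1) by (auto simp: F1_def)
    show "degree f < Suc n" if "f \<in> G - F" for f using that old[of f] by fastforce
    show "pderiv f \<in> G" "truncate f \<in> G" if "f \<in> G" "0 < degree f" "degree f \<le> Suc n" for f
    proof -
      have "pderiv f \<in> G \<and> truncate f \<in> G"
      proof (cases "degree f = Suc n")
        case True
        then have "f \<in> H" using old that by (auto simp: H_def)
        then show ?thesis using G(1) by (auto simp: F1_def)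
      qed (use G(5) that in auto)
      then show "pderiv f \<in> G" "truncate f \<in> G" by auto
    qed
    show "\<exists>r\<in>G. pseudo_remainder f g r"
      if "f \<in> G" "g \<in> G" "0 < degree g" "degree g \<le> Suc n" "degree g \<le> degree f" for f g
    proof (cases "degree g = Suc n")
      case True
      then have "g \<in> H" "f \<in> F" using old that by (auto simp: H_def)
      then have "R f g \<in> G" "pseudo_remainder f g (R f g)"
        using G(1) R[of f g] HF that by (auto simp: F1_def)
      then show ?thesis by blast
    qed (use G(6) that in auto)
  qed (use G in auto)
qed

text \<open>The leading coefficients of the closure of \<open>F\<close> serve as \<open>G\<close>:
  their signs decide the degrees of the specialized polynomials and the signs far out. Together with
  closure under derivatives and pseudo-remainders this is what \<open>sign_matching\<close> asks
  for. As \<open>G\<close> is fixed before the homomorphisms, it can be passed on to an induction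
  over the variables.\<close>

lemma sign_transfer:
  fixes F :: "'c::idom poly set"
  assumes S: "subring_set S" and F: "finite F" "\<And>f i. f \<in> F \<Longrightarrow> coeff f i \<in> S"
  shows "\<exists>G\<subseteq>S. finite G \<and> (\<forall>(\<phi> :: 'c \<Rightarrow> 'a::real_closed_field) (\<psi> :: 'c \<Rightarrow> 'b::real_closed_field).
    comm_ring_hom \<phi> \<longrightarrow> comm_ring_hom \<psi> \<longrightarrow> (\<forall>g\<in>G. same_sign (\<phi> g) (\<psi> g)) \<longrightarrow>
    (\<forall>t. \<exists>u. \<forall>f\<in>F. same_sign (poly (map_poly \<phi> f) t) (poly (map_poly \<psi> f) u)))"
proof -
  define n where "n = Max (insert 0 (degree ` F))"
  have n: "degree f \<le> n" if "f \<in> F" for f using that F by (auto simp: n_def)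
  obtain G where G: "F \<subseteq> G" "finite G" "\<forall>f\<in>G. \<forall>i. coeff f i \<in> S" "\<forall>f\<in>G - F. degree f < n"
    "\<forall>f\<in>G. 0 < degree f \<longrightarrow> degree f \<le> n \<longrightarrow> pderiv f \<in> G \<and> truncate f \<in> G"
    "\<forall>f\<in>G. \<forall>g\<in>G. 0 < degree g \<longrightarrow> degree g \<le> n \<longrightarrow> degree g \<le> degree f \<longrightarrow> (\<exists>r\<in>G. pseudo_remainder f g r)"
    using finite_closure[OF S F, of n] by blast
  have degG: "degree f \<le> n" if "f \<in> G" for f using that n G(4) by (metis DiffI less_imp_le)
  show ?thesis
  proof (intro exI[of _ "lead_coeff ` G"] conjI allI impI)
    fix \<phi> :: "'c \<Rightarrow> 'a" and \<psi> :: "'c \<Rightarrow> 'b" and t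
    assume "comm_ring_hom \<phi>" "comm_ring_hom \<psi>" and sgn: "\<forall>g\<in>lead_coeff ` G. same_sign (\<phi> g) (\<psi> g)"
    interpret phi: comm_ring_hom \<phi> by fact
    interpret psi: comm_ring_hom \<psi> by fact
    define P where "P = insert (0, 0) ((\<lambda>f. (map_poly \<phi> f, map_poly \<psi> f)) ` G)"
    have P0: "(0, 0) \<in> P" by (simp add: P_def)
    have PG: "(map_poly \<phi> f, map_poly \<psi> f) \<in> P" if "f \<in> G" for f using that by (simp add: P_def)
    have lc_sgn: "same_sign (\<phi> (lead_coeff f)) (\<psi> (lead_coeff f))" if "f \<in> G" for f using sgn that by simp
    \<comment> \<open>A leading coefficient that vanishes under one homomorphism vanishes under
      both, as the signs agree, and is truncated away; the process ends with one that
      survives.\<close>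
    have rep: "\<exists>f\<in>G. \<phi> (lead_coeff f) \<noteq> 0 \<and> p = map_poly \<phi> f \<and> q = map_poly \<psi> f"
      if pq: "(p, q) \<in> P" "(p, q) \<noteq> (0, 0)" for p q
    proof -
      obtain f where "f \<in> G" "p = map_poly \<phi> f" "q = map_poly \<psi> f"
        using pq by (auto simp: P_def)
      then show ?thesis
      proof (induction "degree f" arbitrary: f rule: less_induct)
        case less
        show ?case
        proof (cases "\<phi> (lead_coeff f) = 0")
          case True
          then have "\<psi> (lead_coeff f) = 0" using lc_sgn[OF less.prems(1)] same_sign_0_iff by blast
          with True have eq: "map_poly \<phi> (truncate f) = map_poly \<phi> f" "map_poly \<psi> (truncate f) = map_poly \<psi> f"
            by (auto intro!: poly_eqI simp: coeff_map_poly truncate_def phi.hom_diff psi.hom_diff)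
          have "degree f \<noteq> 0"
          proof
            assume "degree f = 0"
            then have "truncate f = 0" by (auto simp: truncate_def monom_0 elim: degree_eq_zeroE)
            then show False using eq less.prems pq(2) by auto
          qed
          then show ?thesis
            using less.hyps[of "truncate f"] eq less.prems G(5) degG degree_truncate[of f] by auto
        qed (use less.prems in blast)
      qed
    qed
    have nz: "\<psi> (lead_coeff f) \<noteq> 0" if "f \<in> G" "\<phi> (lead_coeff f) \<noteq> 0" for f
      using lc_sgn[OF that(1)] that(2) same_sign_0_iff by blast
    have deg_phi: "degree (map_poly \<phi> f) = degree f" if "\<phi> (lead_coeff f) \<noteq> 0" for f
      using that by (intro antisym phi.degree_map_poly_hom_le le_degree) (simp add: coeff_map_poly)
    have deg_psi: "degree (map_poly \<psi> f) = degree f" if "\<psi> (lead_coeff f) \<noteq> 0" for f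
      using that by (intro antisym psi.degree_map_poly_hom_le le_degree) (simp add: coeff_map_poly)
    have "\<exists>u. \<forall>(p, q)\<in>P. same_sign (poly p t) (poly q u)"
    proof (rule sign_matching)
      show "finite P" using G(2) by (simp add: P_def)
      fix p q assume pq: "(p, q) \<in> P"
      have "degree p = degree q \<and> same_sign (lead_coeff p) (lead_coeff q) \<and>
        (0 < degree p \<longrightarrow> (pderiv p, pderiv q) \<in> P)"
      proof (cases "(p, q) = (0, 0)")
        case False
        then obtain f where f: "f \<in> G" "\<phi> (lead_coeff f) \<noteq> 0" "p = map_poly \<phi> f" "q = map_poly \<psi> f"
          using rep pq by blast
        then show ?thesis using deg_phi deg_psi nz lc_sgn G(5) degG PG[of "pderiv f"]
          by (auto simp: coeff_map_poly map_poly_hom_pderiv[OF phi.comm_ring_hom_axioms] map_poly_hom_pderiv[OF psi.comm_ring_hom_axioms])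
      qed (auto simp: same_sign_def)
      then show "degree p = degree q" "same_sign (lead_coeff p) (lead_coeff q)"
        "0 < degree p \<Longrightarrow> (pderiv p, pderiv q) \<in> P" by auto
      fix p' q' assume pq': "(p', q') \<in> P" "0 < degree p" "degree p \<le> degree p'"
      obtain f where f: "f \<in> G" "\<phi> (lead_coeff f) \<noteq> 0" "p = map_poly \<phi> f" "q = map_poly \<psi> f"
        using rep pq pq' by force
      obtain f' where f': "f' \<in> G" "\<phi> (lead_coeff f') \<noteq> 0" "p' = map_poly \<phi> f'" "q' = map_poly \<psi> f'"
        using rep[of p' q'] pq' by force
      have "\<exists>r\<in>G. pseudo_remainder f' f r"
        using G(6) f f' pq' degG deg_phi by auto
      then obtain r m g where r: "r \<in> G" "degree r < degree f" "smult (lead_coeff f ^ (2 * m)) f' = f * g + r"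
        by (auto simp: pseudo_remainder_def)
      have "smult (\<phi> (lead_coeff f) ^ (2 * m)) p' = p * map_poly \<phi> g + map_poly \<phi> r"
        using arg_cong[OF r(3), of "map_poly \<phi>"] f f'
        by (simp add: phi.map_poly_hom_smult phi.map_poly_hom_add phi.map_poly_hom_mult phi.hom_power)
      moreover have "smult (\<psi> (lead_coeff f) ^ (2 * m)) q' = q * map_poly \<psi> g + map_poly \<psi> r"
        using arg_cong[OF r(3), of "map_poly \<psi>"] f f'
        by (simp add: psi.map_poly_hom_smult psi.map_poly_hom_add psi.map_poly_hom_mult psi.hom_power)
      moreover have "degree (map_poly \<phi> r) < degree p"
        using le_less_trans[OF phi.degree_map_poly_hom_le r(2)] f deg_phi by simp
      moreover have "0 < \<phi> (lead_coeff f) ^ (2 * m)" "0 < \<psi> (lead_coeff f) ^ (2 * m)"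
        using f nz by (simp_all add: power_mult)
      ultimately show "\<exists>r s c d g h. (r, s) \<in> P \<and> degree r < degree p \<and> 0 < c \<and> 0 < d \<and>
        smult c p' = p * g + r \<and> smult d q' = q * h + s"
        using PG[OF r(1)] by blast
    qed
    then obtain u where "\<forall>(p, q)\<in>P. same_sign (poly p t) (poly q u)" by blast
    then show "\<exists>u. \<forall>f\<in>F. same_sign (poly (map_poly \<phi> f) t) (poly (map_poly \<psi> f) u)"
      using PG G(1) by (intro exI[of _ u]) blast
  qed (use G in auto)
qed

section \<open>Multivariate polynomials\<close>

no_notation fps_nth (infixl "$" 75)

text \<open>Multiplication of poly-mappings makes an integral domain only for linearly ordered exponents, which
  the variable type \<open>'n\<close> need not provide. The copy \<open>'n mp\<close> can be declared an integral domain for all finite \<open>'n\<close>,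
  and then has a fraction field.\<close>

typedef 'n mp = "UNIV :: 'n real_mpoly set"
  morphisms raw Mp by auto

setup_lifting type_definition_mp

instantiation mp :: (type) comm_ring_1
begin

lift_definition zero_mp :: "'a mp" is 0 .
lift_definition one_mp :: "'a mp" is 1 .
lift_definition plus_mp :: "'a mp \<Rightarrow> 'a mp \<Rightarrow> 'a mp" is "(+)" .
lift_definition minus_mp :: "'a mp \<Rightarrow> 'a mp \<Rightarrow> 'a mp" is "(-)" .
lift_definition uminus_mp :: "'a mp \<Rightarrow> 'a mp" is uminus .
lift_definition times_mp :: "'a mp \<Rightarrow> 'a mp \<Rightarrow> 'a mp" is "(*)" .

instance
  by standard (transfer; simp add: algebra_simps)+

end

lift_definition Const :: "real \<Rightarrow> 'n mp" is "\<lambda>c. Poly_Mapping.single 0 c" .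
lift_definition Var :: "'n \<Rightarrow> 'n mp" is "\<lambda>i. Poly_Mapping.single (Poly_Mapping.single i 1) 1" .

interpretation Const: comm_ring_hom Const
  by standard (transfer; simp add: single_add mult_single)+

lemma poly_mapping_eq_sum_single: "F = (\<Sum>m\<in>Poly_Mapping.keys F. Poly_Mapping.single m (Poly_Mapping.lookup F m))"
proof (rule poly_mapping_eqI)
  fix k
  have "Poly_Mapping.lookup (\<Sum>m\<in>Poly_Mapping.keys F. Poly_Mapping.single m (Poly_Mapping.lookup F m)) k =
      (\<Sum>m\<in>Poly_Mapping.keys F. if m = k then Poly_Mapping.lookup F k else 0)"
    unfolding lookup_sum lookup_single by (intro sum.cong) (auto simp: when_def)
  also have "\<dots> = Poly_Mapping.lookup F k"
    by (simp add: in_keys_iff)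
  finally show "Poly_Mapping.lookup F k = Poly_Mapping.lookup
      (\<Sum>m\<in>Poly_Mapping.keys F. Poly_Mapping.single m (Poly_Mapping.lookup F m)) k" by simp
qed

definition subst_raw :: "(real \<Rightarrow> 'b::comm_ring_1) \<Rightarrow> ('n::finite \<Rightarrow> 'b) \<Rightarrow> 'n real_mpoly \<Rightarrow> 'b" where
  "subst_raw h x F = (\<Sum>m\<in>Poly_Mapping.keys F. h (Poly_Mapping.lookup F m) * (\<Prod>i\<in>UNIV. x i ^ Poly_Mapping.lookup m i))"

context
  fixes h :: "real \<Rightarrow> 'b::comm_ring_1"
  assumes h: "comm_ring_hom h"
begin

interpretation comm_ring_hom h by (fact h)

lemma subst_raw_superset:
  assumes "finite A" "Poly_Mapping.keys F \<subseteq> A"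
  shows "subst_raw h x F = (\<Sum>m\<in>A. h (Poly_Mapping.lookup F m) * (\<Prod>i\<in>UNIV. x i ^ Poly_Mapping.lookup m i))"
  unfolding subst_raw_def using assms by (intro sum.mono_neutral_left) (auto simp: in_keys_iff)

lemma subst_raw_add: "subst_raw h x (F + G) = subst_raw h x F + subst_raw h x G"
proof -
  let ?A = "Poly_Mapping.keys F \<union> Poly_Mapping.keys G"
  have "Poly_Mapping.keys (F + G) \<subseteq> ?A" by (rule keys_add)
  then show ?thesis
    by (simp add: subst_raw_superset[of ?A] lookup_add hom_add algebra_simps sum.distrib)
qed

lemma subst_raw_sum: "subst_raw h x (sum F A) = (\<Sum>i\<in>A. subst_raw h x (F i))"
proof (induction A rule: infinite_finite_induct)
  case (insert a A)
  then show ?case by (simp add: subst_raw_add)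
qed (simp_all add: subst_raw_def)

lemma subst_raw_single:
  "subst_raw h x (Poly_Mapping.single m c) = h c * (\<Prod>i\<in>UNIV. x i ^ Poly_Mapping.lookup m i)"
  by (simp add: subst_raw_superset[of "{m}"])

lemma subst_raw_mult: "subst_raw h x (F * G) = subst_raw h x F * subst_raw h x G"
proof -
  let ?s = "\<lambda>H m. Poly_Mapping.single m (Poly_Mapping.lookup H m)"
  have single: "subst_raw h x (?s F m * ?s G n) = subst_raw h x (?s F m) * subst_raw h x (?s G n)" for m n
    by (simp add: mult_single subst_raw_single lookup_add power_add prod.distrib hom_mult algebra_simps)
  have "subst_raw h x (F * G) =
      subst_raw h x ((\<Sum>m\<in>Poly_Mapping.keys F. ?s F m) * (\<Sum>n\<in>Poly_Mapping.keys G. ?s G n))"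
    by (simp flip: poly_mapping_eq_sum_single)
  also have "\<dots> = (\<Sum>m\<in>Poly_Mapping.keys F. subst_raw h x (?s F m)) * (\<Sum>n\<in>Poly_Mapping.keys G. subst_raw h x (?s G n))"
    by (simp add: sum_product subst_raw_sum single)
  also have "\<dots> = subst_raw h x F * subst_raw h x G"
    by (simp flip: subst_raw_sum poly_mapping_eq_sum_single)
  finally show ?thesis .
qed

end

text \<open>Real evaluation, \<open>as_poly\<close> and \<open>homogenization\<close> are instances,
  and all of them become homomorphisms by \<open>comm_ring_hom_subst\<close>.\<close>

definition subst :: "(real \<Rightarrow> 'b::comm_ring_1) \<Rightarrow> ('n::finite \<Rightarrow> 'b) \<Rightarrow> 'n mp \<Rightarrow> 'b" where
  "subst h x f = subst_raw h x (raw f)"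

lemma subst_Const: "comm_ring_hom h \<Longrightarrow> subst h x (Const c) = h c"
  by (simp add: subst_def Const.rep_eq subst_raw_single)

lemma subst_Var:
  assumes "comm_ring_hom h"
  shows "subst h x (Var i) = x i"
proof -
  interpret comm_ring_hom h by fact
  have "subst h x (Var i) = (\<Prod>j\<in>UNIV. x j ^ (if i = j then Suc 0 else 0))"
    by (simp add: subst_def Var.rep_eq subst_raw_single[OF assms] lookup_single when_def hom_one cong: if_cong)
  also have "\<dots> = (\<Prod>j\<in>UNIV. if j = i then x i else 1)"
    by (intro prod.cong) auto
  finally have "subst h x (Var i) = (\<Prod>j\<in>UNIV. if j = i then x i else 1)" .
  then show ?thesis by simp
qed

lemma comm_ring_hom_subst:
  assumes "comm_ring_hom h"
  shows "comm_ring_hom (subst h x)"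
proof
  show "subst h x 1 = 1"
    using subst_Const[OF assms, of x 1] by (simp add: Const.hom_one comm_ring_hom.hom_one[OF assms])
qed (simp_all add: subst_def plus_mp.rep_eq times_mp.rep_eq subst_raw_add[OF assms] subst_raw_mult[OF assms])

inductive_set polys_in :: "'n set \<Rightarrow> 'n mp set" for V where
  Const: "Const c \<in> polys_in V"
| Var: "i \<in> V \<Longrightarrow> Var i \<in> polys_in V"
| add: "f \<in> polys_in V \<Longrightarrow> g \<in> polys_in V \<Longrightarrow> f + g \<in> polys_in V"
| mult: "f \<in> polys_in V \<Longrightarrow> g \<in> polys_in V \<Longrightarrow> f * g \<in> polys_in V"

lemma subring_set_polys_in: "subring_set (polys_in V)"
proof -
  have "1 \<in> polys_in V" using polys_in.Const[of 1 V] by (simp add: Const.hom_one)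
  moreover have "f - g \<in> polys_in V" if "f \<in> polys_in V" "g \<in> polys_in V" for f g
    using polys_in.add[OF that(1) polys_in.mult[OF polys_in.Const[of "-1"] that(2)]]
    by (simp add: Const.hom_uminus Const.hom_one)
  ultimately show ?thesis by (auto simp: subring_set_def polys_in.mult)
qed

lemma polys_in_mono: "f \<in> polys_in V \<Longrightarrow> V \<subseteq> W \<Longrightarrow> f \<in> polys_in W"
  by (induction rule: polys_in.induct) (auto intro: polys_in.intros)

lemma polys_in_empty: "f \<in> polys_in {} \<Longrightarrow> \<exists>c. f = Const c"
  by (induction rule: polys_in.induct) (auto simp flip: Const.hom_add Const.hom_mult)

text \<open>Turns the rules of \<open>polys_in\<close> into structural induction for all
  polynomials; homomorphisms then need to be compared only on constants and variables.\<close>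

lemma polys_in_UNIV: "(f :: 'n::finite mp) \<in> polys_in UNIV"
proof -
  note S = subring_set_polys_in[of UNIV]
  have pow: "Mp (Poly_Mapping.single (Poly_Mapping.single i n) 1) = Var i ^ n" for i :: 'n and n
  proof (induction n)
    case (Suc n)
    have "Mp (Poly_Mapping.single (Poly_Mapping.single i (Suc n)) 1) =
      Var i * Mp (Poly_Mapping.single (Poly_Mapping.single i n) 1)"
      by (simp add: Var_def times_mp.abs_eq eq_onp_def mult_single flip: single_add)
    with Suc show ?case by simp
  qed (simp add: one_mp.abs_eq flip: single_one)
  have exponents: "m = (\<Sum>i\<in>UNIV. Poly_Mapping.single i (Poly_Mapping.lookup m i))" for m :: "'n \<Rightarrow>\<^sub>0 nat"
    by (rule poly_mapping_eqI) (simp add: lookup_sum lookup_single when_def)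
  have sum_prod: "Mp (Poly_Mapping.single (\<Sum>i\<in>A. m i) 1) = (\<Prod>i\<in>A. Mp (Poly_Mapping.single (m i) 1))"
    if "finite A" for A and m :: "'n \<Rightarrow> 'n \<Rightarrow>\<^sub>0 nat"
    using that
  proof (induction A)
    case (insert i A)
    have "Mp (Poly_Mapping.single (m i + sum m A) 1) = Mp (Poly_Mapping.single (m i) 1) * Mp (Poly_Mapping.single (sum m A) 1)"
      by (simp add: times_mp.abs_eq eq_onp_def mult_single)
    with insert show ?case by simp
  qed (simp add: one_mp.abs_eq flip: single_one)
  have monomial: "Mp (Poly_Mapping.single m c) \<in> polys_in UNIV" for m :: "'n \<Rightarrow>\<^sub>0 nat" and c
  proof -
    have "Mp (Poly_Mapping.single m c) = Const c * Mp (Poly_Mapping.single m 1)"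
      by (simp add: Const_def times_mp.abs_eq eq_onp_def mult_single)
    also have "Mp (Poly_Mapping.single m 1) = (\<Prod>i\<in>UNIV. Var i ^ Poly_Mapping.lookup m i)"
      by (subst exponents) (simp add: sum_prod pow)
    finally show ?thesis
      by (auto intro!: polys_in.intros subring_prod[OF S] subring_power[OF S])
  qed
  have sum: "Mp (sum F A) = (\<Sum>i\<in>A. Mp (F i))" if "finite A" for F :: "('n \<Rightarrow>\<^sub>0 nat) \<Rightarrow> 'n real_mpoly" and A
    using that
  proof (induction A)
    case (insert i A)
    have "Mp (F i + sum F A) = Mp (F i) + Mp (sum F A)" by (simp add: plus_mp.abs_eq eq_onp_def)
    with insert show ?case by simp
  qed (simp add: zero_mp.abs_eq)
  have "f = Mp (raw f)" by (simp add: raw_inverse)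
  also have "\<dots> = (\<Sum>m\<in>Poly_Mapping.keys (raw f). Mp (Poly_Mapping.single m (Poly_Mapping.lookup (raw f) m)))"
    by (subst poly_mapping_eq_sum_single) (simp add: sum)
  also have "\<dots> \<in> polys_in UNIV" by (intro subring_sum[OF S] monomial)
  finally show ?thesis .
qed

lemma comm_ring_hom_eqI:
  fixes g h :: "'n::finite mp \<Rightarrow> 'b::comm_ring_1"
  assumes "comm_ring_hom g" "comm_ring_hom h" "\<And>c. g (Const c) = h (Const c)" "\<And>i. i \<in> V \<Longrightarrow> g (Var i) = h (Var i)"
    and "f \<in> polys_in V"
  shows "g f = h f"
proof -
  interpret g: comm_ring_hom g by fact
  interpret h: comm_ring_hom h by fact
  show ?thesis using assms(5)
    by induction (simp_all add: assms(3,4) g.hom_add g.hom_mult h.hom_add h.hom_mult)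
qed

section \<open>Evaluation at real points and polynomials in one distinguished variable\<close>

definition evalp :: "'n::finite mp \<Rightarrow> real ^ 'n \<Rightarrow> real" where
  "evalp f x = subst (\<lambda>c. c) (($) x) f"

lemma comm_ring_hom_id: "comm_ring_hom (\<lambda>c. c)"
  by standard auto

interpretation evalp: comm_ring_hom "\<lambda>f. evalp f x" for x
  unfolding evalp_def by (rule comm_ring_hom_subst[OF comm_ring_hom_id])

lemma eval_Const [simp]: "evalp (Const c) x = c" and eval_Var [simp]: "evalp (Var i) x = x $ i"
  by (simp_all add: evalp_def subst_Const[OF comm_ring_hom_id] subst_Var[OF comm_ring_hom_id])

lemma eval_mpoly_raw: "eval_mpoly (raw f) x = evalp f x"
  by (simp add: eval_mpoly_def evalp_def subst_def subst_raw_def)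

lemma eval_cong:
  assumes "f \<in> polys_in V" "\<And>i. i \<in> V \<Longrightarrow> x $ i = y $ i"
  shows "evalp f x = evalp f y"
  by (rule comm_ring_hom_eqI[OF evalp.comm_ring_hom_axioms evalp.comm_ring_hom_axioms _ _ assms(1)]) (simp_all add: assms(2))

lemma comm_ring_hom_pCons:
  assumes "comm_ring_hom h"
  shows "comm_ring_hom (\<lambda>c. [:h c:])"
  using assms by (simp add: comm_ring_hom_def one_pCons)

lemma comm_ring_hom_poly: "comm_ring_hom (\<lambda>p. poly p x)"
  by standard auto

text \<open>The coefficients stay in the type \<open>'n mp\<close> although they do not involve
  \<open>k\<close>, so variables can be removed one by one without a change of type.\<close>

definition as_poly :: "'n \<Rightarrow> 'n::finite mp \<Rightarrow> 'n mp poly" where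
  "as_poly k = subst (\<lambda>c. [:Const c:]) (\<lambda>i. if i = k then [:0, 1:] else [:Var i:])"

interpretation as_poly: comm_ring_hom "as_poly k" for k :: "'n::finite"
  unfolding as_poly_def by (rule comm_ring_hom_subst[OF comm_ring_hom_pCons[OF Const.comm_ring_hom_axioms]])

lemma as_poly_Const [simp]: "as_poly k (Const c) = [:Const c:]"
  and as_poly_Var: "as_poly k (Var i) = (if i = k then [:0, 1:] else [:Var i:])"
  by (simp_all add: as_poly_def subst_Const subst_Var comm_ring_hom_pCons[OF Const.comm_ring_hom_axioms])

lemma poly_as_poly: "poly (as_poly k f) (Var k) = f"
  by (rule comm_ring_hom_eqI[OF comm_ring_hom_comp[OF comm_ring_hom_poly as_poly.comm_ring_hom_axioms]
        comm_ring_hom_id _ _ polys_in_UNIV]) (simp_all add: as_poly_Var)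

lemma as_poly_eq_0_iff [simp]: "as_poly k f = 0 \<longleftrightarrow> f = 0"
  using poly_as_poly[of k f] by auto

lemma coeff_as_poly:
  assumes "f \<in> polys_in V"
  shows "coeff (as_poly k f) i \<in> polys_in (V - {k})"
proof -
  let ?T = "{p. \<forall>i. coeff p i \<in> polys_in (V - {k})}"
  note S = subring_set_polys_in[of "V - {k}"]
  note T = subring_set_polys[OF S]
  have "as_poly k f \<in> ?T"
    using assms
  proof induction
    case (add f g)
    show ?case unfolding as_poly.hom_add by (rule subring_add[OF T add.IH])
  next
    case (mult f g)
    show ?case unfolding as_poly.hom_mult by (rule subring_mult[OF T mult.IH])
  qed (auto simp: as_poly_Var coeff_pCons subring_zero[OF S] subring_one[OF S] split: nat.splits intro: polys_in.intros)
  then show ?thesis by simp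
qed

lemma as_poly_const:
  assumes "f \<in> polys_in V" "k \<notin> V"
  shows "as_poly k f = [:f:]"
  by (rule comm_ring_hom_eqI[OF as_poly.comm_ring_hom_axioms comm_ring_hom_pCons[OF comm_ring_hom_id] _ _ assms(1)])
    (use assms(2) in \<open>auto simp: as_poly_Var\<close>)

lemma eval_as_poly:
  "evalp f (\<chi> i. if i = k then u else a $ i) = poly (map_poly (\<lambda>c. evalp c a) (as_poly k f)) u"
proof -
  let ?b = "\<chi> i. if i = k then u else a $ i"
  have "evalp f ?b = evalp (poly (as_poly k f) (Var k)) ?b" by (simp add: poly_as_poly)
  also have "\<dots> = poly (map_poly (\<lambda>c. evalp c ?b) (as_poly k f)) u"
    by (simp flip: evalp.poly_map_poly_hom)
  also have "map_poly (\<lambda>c. evalp c ?b) (as_poly k f) = map_poly (\<lambda>c. evalp c a) (as_poly k f)"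
  proof (rule poly_eqI)
    fix i
    have "evalp (coeff (as_poly k f) i) ?b = evalp (coeff (as_poly k f) i) a"
      by (rule eval_cong[OF coeff_as_poly[OF polys_in_UNIV]]) auto
    then show "coeff (map_poly (\<lambda>c. evalp c ?b) (as_poly k f)) i = coeff (map_poly (\<lambda>c. evalp c a) (as_poly k f)) i"
      by (simp add: coeff_map_poly)
  qed
  finally show ?thesis .
qed

text \<open>By induction some coefficient with respect to \<open>k\<close> is nonzero at a nearby
  point. The univariate polynomial obtained there is nonzero, and its finitely many roots cannot
  fill an interval around \<open>b $ k\<close>.\<close>

lemma eval_nonzero_near:
  fixes f :: "'n::finite mp"
  assumes "f \<noteq> 0" "0 < e"
  shows "\<exists>a. (\<forall>i. \<bar>a $ i - b $ i\<bar> < e) \<and> evalp f a \<noteq> 0"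
proof -
  have "\<forall>f\<in>polys_in V. f \<noteq> 0 \<longrightarrow> (\<exists>a. (\<forall>i. \<bar>a $ i - b $ i\<bar> < e) \<and> evalp f a \<noteq> 0)" for V :: "'n set"
    using finite[of V]
  proof (induction V)
    case empty
    show ?case
    proof (intro ballI impI exI[of _ b] conjI allI)
      fix f :: "'n mp" assume f: "f \<in> polys_in {}" "f \<noteq> 0"
      obtain c where "f = Const c" using polys_in_empty[OF f(1)] by blast
      with f(2) show "evalp f b \<noteq> 0" by (cases "c = 0") auto
    qed (simp add: \<open>0 < e\<close>)
  next
    case (insert k V)
    show ?case
    proof (intro ballI impI)
      fix f :: "'n mp" assume f: "f \<in> polys_in (insert k V)" "f \<noteq> 0"
      then obtain j where j: "coeff (as_poly k f) j \<noteq> 0" by (metis as_poly_eq_0_iff leading_coeff_0_iff)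
      have "coeff (as_poly k f) j \<in> polys_in V"
        using coeff_as_poly[OF f(1), of k j] insert(2) by simp
      then obtain a where a: "\<forall>i. \<bar>a $ i - b $ i\<bar> < e" "evalp (coeff (as_poly k f) j) a \<noteq> 0"
        using insert.IH j by blast
      let ?q = "map_poly (\<lambda>c. evalp c a) (as_poly k f)"
      have "coeff ?q j \<noteq> 0" using a by (simp add: coeff_map_poly)
      then have "finite {u. poly ?q u = 0}" by (intro poly_roots_finite) auto
      moreover have "infinite {b $ k - e <..< b $ k + e}" using \<open>0 < e\<close> by (intro infinite_Ioo) simp
      ultimately obtain u where u: "u \<in> {b $ k - e <..< b $ k + e}" "poly ?q u \<noteq> 0"
        by (metis (mono_tags, lifting) finite_subset mem_Collect_eq subsetI)
      show "\<exists>a. (\<forall>i. \<bar>a $ i - b $ i\<bar> < e) \<and> evalp f a \<noteq> 0"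
      proof (intro exI conjI allI)
        let ?a = "\<chi> i. if i = k then u else a $ i"
        show "\<bar>?a $ i - b $ i\<bar> < e" for i
          using a(1) u(1) by (cases "i = k") (auto simp: abs_less_iff)
        show "evalp f ?a \<noteq> 0"
          using u(2) unfolding eval_as_poly .
      qed
    qed
  qed
  from mp[OF bspec[OF this polys_in_UNIV] assms(1)] show ?thesis .
qed

lemma isCont_eval: "isCont (evalp f) x"
  using polys_in_UNIV[of f]
proof induction
  case (Const c)
  have "evalp (Const c) = (\<lambda>x. c)" by (simp add: fun_eq_iff)
  then show ?case by simp
next
  case (Var i)
  have "evalp (Var i) = (\<lambda>x. x $ i)" by (simp add: fun_eq_iff)
  then show ?case by simp
next
  case (add f g)
  have "evalp (f + g) = (\<lambda>x. evalp f x + evalp g x)" by (simp add: fun_eq_iff evalp.hom_add)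
  with add show ?case by simp
next
  case (mult f g)
  have "evalp (f * g) = (\<lambda>x. evalp f x * evalp g x)" by (simp add: fun_eq_iff evalp.hom_mult)
  with mult show ?case by simp
qed

lemma eval_pos_near:
  assumes "0 < evalp f a"
  shows "\<exists>e>0. \<forall>x. (\<forall>i. \<bar>x $ i - a $ i\<bar> < e) \<longrightarrow> 0 < evalp f x"
proof -
  have "eventually (\<lambda>x. 0 < evalp f x) (nhds a)"
    using order_tendstoD(1)[OF isCont_eval[unfolded isCont_def] assms] assms
    by (simp add: eventually_at_filter) (auto elim: eventually_mono)
  then obtain d where d: "d > 0" "\<And>x. dist x a < d \<Longrightarrow> 0 < evalp f x"
    by (auto simp: eventually_nhds_metric)
  \<comment> \<open>A box of this size lies in the ball of radius \<open>d\<close>, as the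
    coordinate distances sum to less than \<open>d\<close>.\<close>
  have "0 < evalp f x" if "\<forall>i. \<bar>x $ i - a $ i\<bar> < d / (CARD('a) + 1)" for x
  proof (rule d)
    have "dist x a \<le> (\<Sum>i\<in>UNIV. \<bar>(x - a) $ i\<bar>)" unfolding dist_norm by (rule norm_le_l1_cart)
    also have "\<dots> \<le> (\<Sum>i\<in>(UNIV :: 'a set). d / (CARD('a) + 1))"
      using that by (intro sum_mono) (auto intro: less_imp_le)
    also have "\<dots> < d" using d(1) by (simp add: field_simps)
    finally show "dist x a < d" .
  qed
  then show ?thesis using d(1) by (intro exI[of _ "d / (CARD('a) + 1)"]) auto
qed

text \<open>\<open>f\<close> is nonzero on a box around some point, and \<open>g\<close> is nonzero
  somewhere in this box. The square \<open>f * f\<close> makes \<open>eval_pos_near\<close>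
  applicable whatever the sign of \<open>f\<close>.\<close>

lemma mp_mult_nonzero:
  fixes f g :: "'n::finite mp"
  assumes "f \<noteq> 0" "g \<noteq> 0"
  shows "f * g \<noteq> 0"
proof -
  obtain a where "evalp f a \<noteq> 0" using eval_nonzero_near[OF assms(1) zero_less_one] by blast
  then have "0 < evalp (f * f) a" by (auto simp: evalp.hom_mult zero_less_mult_iff neq_iff)
  from eval_pos_near[OF this] obtain e where e: "e > 0" "\<forall>x. (\<forall>i. \<bar>x $ i - a $ i\<bar> < e) \<longrightarrow> 0 < evalp (f * f) x"
    by blast
  obtain b where "\<forall>i. \<bar>b $ i - a $ i\<bar> < e" "evalp g b \<noteq> 0" using eval_nonzero_near[OF assms(2) e(1)] by blast
  moreover from this have "evalp f b \<noteq> 0" using e(2) by (force simp: evalp.hom_mult)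
  ultimately have "evalp (f * g) b \<noteq> 0" by (simp add: evalp.hom_mult)
  then show ?thesis by (intro notI) simp
qed

instance mp :: (finite) idom
  by standard (rule mp_mult_nonzero)

section \<open>Total degree and units\<close>

definition homogenization :: "'n::finite mp \<Rightarrow> 'n mp poly" where
  "homogenization = subst (\<lambda>c. [:Const c:]) (\<lambda>i. [:0, Var i:])"

interpretation homogenization: comm_ring_hom "homogenization :: 'n::finite mp \<Rightarrow> _"
  unfolding homogenization_def by (rule comm_ring_hom_subst[OF comm_ring_hom_pCons[OF Const.comm_ring_hom_axioms]])

lemma homogenization_Const: "homogenization (Const c) = [:Const c:]"
  and homogenization_Var: "homogenization (Var i) = [:0, Var i:]"
  by (simp_all add: homogenization_def subst_Const subst_Var comm_ring_hom_pCons[OF Const.comm_ring_hom_axioms])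

lemma poly_homogenization_1: "poly (homogenization f) 1 = f"
  by (rule comm_ring_hom_eqI[OF comm_ring_hom_comp[OF comm_ring_hom_poly homogenization.comm_ring_hom_axioms]
        comm_ring_hom_id _ _ polys_in_UNIV]) (simp_all add: homogenization_Const homogenization_Var)

lemma poly_homogenization_0: "poly (homogenization f) 0 = Const (evalp f 0)"
  by (rule comm_ring_hom_eqI[OF comm_ring_hom_comp[OF comm_ring_hom_poly homogenization.comm_ring_hom_axioms]
        comm_ring_hom_comp[OF Const.comm_ring_hom_axioms evalp.comm_ring_hom_axioms] _ _ polys_in_UNIV])
    (simp_all add: homogenization_Const homogenization_Var)

text \<open>In \<open>homogenization f\<close> each variable \<open>z_i\<close> is replaced by
  \<open>z_i T\<close>, so the degree in \<open>T\<close> is the total degree. It is additive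
  because degrees in one variable over an integral domain are.\<close>

definition tdeg :: "'n::finite mp \<Rightarrow> nat" where
  "tdeg f = degree (homogenization f)"

lemma tdeg_mult:
  assumes "f \<noteq> 0" "g \<noteq> 0"
  shows "tdeg (f * g) = tdeg f + tdeg g"
proof -
  have "homogenization f \<noteq> 0" "homogenization g \<noteq> 0"
    using assms poly_homogenization_1[of f] poly_homogenization_1[of g] by auto
  then show ?thesis by (simp add: tdeg_def homogenization.hom_mult degree_mult_eq)
qed

lemma tdeg_eq_0D:
  assumes "tdeg f = 0"
  shows "f = Const (evalp f 0)"
proof -
  obtain c where "homogenization f = [:c:]" using assms unfolding tdeg_def by (rule degree_eq_zeroE)
  then show ?thesis using poly_homogenization_0[of f] poly_homogenization_1[of f] by simp
qed

lemma Const_dvd_1: "c \<noteq> 0 \<Longrightarrow> Const c dvd 1"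
  by (rule dvdI[of _ _ "Const (1 / c)"]) (simp add: Const.hom_one flip: Const.hom_mult)

lemma tdeg_Const [simp]: "tdeg (Const c) = 0"
  by (simp add: tdeg_def homogenization_Const)

lemma dvd_1_iff_tdeg: "f dvd 1 \<longleftrightarrow> f \<noteq> 0 \<and> tdeg f = 0"
proof
  assume "f dvd 1"
  then obtain g where g: "1 = f * g" by (rule dvdE)
  then have nz: "f \<noteq> 0" "g \<noteq> 0" by auto
  have "tdeg (1 :: 'a mp) = 0" using tdeg_Const[of 1] by (simp add: Const.hom_one)
  then show "f \<noteq> 0 \<and> tdeg f = 0" using tdeg_mult[OF nz] nz by (simp flip: g)
next
  assume "f \<noteq> 0 \<and> tdeg f = 0"
  then show "f dvd 1" using tdeg_eq_0D[of f] Const_dvd_1 by (metis Const.hom_zero)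
qed

section \<open>Maximal formally real subfields\<close>

inductive_set sos_in :: "'a::comm_ring_1 set \<Rightarrow> 'a set" for S where
  zero: "0 \<in> sos_in S"
| add: "x \<in> S \<Longrightarrow> y \<in> sos_in S \<Longrightarrow> x * x + y \<in> sos_in S"

lemma sos_in_square: "x \<in> S \<Longrightarrow> x * x \<in> sos_in S"
  using sos_in.add[OF _ sos_in.zero] by fastforce

lemma sos_in_add: "x \<in> sos_in S \<Longrightarrow> y \<in> sos_in S \<Longrightarrow> x + y \<in> sos_in S"
  by (induction rule: sos_in.induct) (auto simp: add.assoc intro: sos_in.add)

lemma sos_in_mono: "x \<in> sos_in S \<Longrightarrow> S \<subseteq> T \<Longrightarrow> x \<in> sos_in T"
  by (induction rule: sos_in.induct) (auto intro: sos_in.intros)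

lemma sos_in_subset: "subring_set S \<Longrightarrow> x \<in> sos_in S \<Longrightarrow> x \<in> S"
  by (rotate_tac, induction rule: sos_in.induct) (auto intro: subring_zero subring_add subring_mult)

lemma sos_in_mult:
  assumes S: "subring_set S" and "x \<in> sos_in S" "y \<in> sos_in S"
  shows "x * y \<in> sos_in S"
proof -
  have square: "(u * u) * y \<in> sos_in S" if "u \<in> S" "y \<in> sos_in S" for u y
    using that(2)
  proof induction
    case (add x y)
    have "(u * u) * (x * x + y) = (u * x) * (u * x) + (u * u) * y" by (simp add: algebra_simps)
    then show ?case using add that(1) by (auto intro: sos_in.add subring_mult[OF S])
  qed (simp add: sos_in.zero)
  show ?thesis
    using assms(2)
  proof induction
    case (add x z)
    then show ?case using square[OF _ assms(3)] by (auto simp: distrib_right intro: sos_in_add)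
  qed (simp add: sos_in.zero)
qed

text \<open>The last condition is formal reality, the algebraic substitute for an ordering.\<close>

definition real_subfield :: "'a::field set \<Rightarrow> bool" where
  "real_subfield S \<longleftrightarrow> subring_set S \<and> (\<forall>x\<in>S. inverse x \<in> S) \<and> - 1 \<notin> sos_in S"

text \<open>For \<open>b\<close> outside \<open>S\<close>, the extension \<open>T\<close> consists
  of the elements \<open>x + y * b\<close>. A sum of squares in \<open>T\<close> has the form
  \<open>s + a * t + v * b\<close> with sums of squares \<open>s\<close>, \<open>t\<close> of
  \<open>S\<close>. If it were \<open>- 1\<close>, then \<open>v = 0\<close>, as otherwise
  \<open>b\<close> would lie in \<open>S\<close>, and \<open>1 + s + a * t = 0\<close> is
  excluded.\<close>

lemma real_subfield_adjoin_sqrt: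
  fixes b :: "'a::field"
  assumes S: "real_subfield S" and a: "b * b = a" "a \<in> S"
    and nonzero: "\<And>s t. s \<in> sos_in S \<Longrightarrow> t \<in> sos_in S \<Longrightarrow> 1 + s + a * t \<noteq> 0"
  shows "\<exists>T. real_subfield T \<and> S \<subseteq> T \<and> b \<in> T"
proof (cases "b \<in> S")
  case False
  have sub: "subring_set S" and inv: "\<And>x. x \<in> S \<Longrightarrow> inverse x \<in> S"
    using S by (auto simp: real_subfield_def)
  note closed = subring_zero[OF sub] subring_one[OF sub] subring_add[OF sub] subring_diff[OF sub]
    subring_mult[OF sub] subring_uminus[OF sub]
  define T where "T = {x + y * b |x y. x \<in> S \<and> y \<in> S}"
  have T: "x + y * b \<in> T" if "x \<in> S" "y \<in> S" for x y using that by (auto simp: T_def)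
  have ST: "S \<subseteq> T" using T[OF _ closed(1)] by auto
  have bT: "b \<in> T" using T[OF closed(1,2)] by simp
  have div: "x / y \<in> S" if "x \<in> S" "y \<in> S" for x y
    using that inv closed by (simp add: field_class.field_divide_inverse)
  have subT: "subring_set T"
    unfolding subring_set_def
  proof (intro conjI ballI)
    show "1 \<in> T" using ST closed(2) by blast
    fix u v assume "u \<in> T" "v \<in> T"
    then obtain x y z w where uv: "u = x + y * b" "v = z + w * b" "x \<in> S" "y \<in> S" "z \<in> S" "w \<in> S"
      by (auto simp: T_def)
    have eq: "u - v = (x - z) + (y - w) * b" "u * v = (x * z + y * w * a) + (x * w + y * z) * b"
      unfolding uv a(1)[symmetric] by (simp_all add: algebra_simps)
    show "u - v \<in> T" unfolding eq(1) using uv by (intro T closed)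
    show "u * v \<in> T" unfolding eq(2) using uv a(2) by (intro T closed)
  qed
  have invT: "inverse u \<in> T" if uT: "u \<in> T" for u
  proof (cases "u = 0")
    case False
    obtain x y where u: "u = x + y * b" "x \<in> S" "y \<in> S" using uT by (auto simp: T_def)
    \<comment> \<open>The conjugate of \<open>u\<close>, by which the denominator of
      \<open>1 / u\<close> is rationalized.\<close>
    have "x - y * b \<noteq> 0"
    proof
      assume *: "x - y * b = 0"
      show False
      proof (cases "y = 0")
        case False
        then have "b = x / y" using * by (simp add: field_simps)
        then show False using div u \<open>b \<notin> S\<close> by blast
      qed (use * u \<open>u \<noteq> 0\<close> in simp)
    qed
    moreover have eq: "u * (x - y * b) = x * x - a * (y * y)"
      unfolding u a(1)[symmetric] by (simp add: algebra_simps)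
    ultimately have nz: "x * x - a * (y * y) \<noteq> 0" using \<open>u \<noteq> 0\<close> by (metis mult_eq_0_iff)
    let ?d = "x * x - a * (y * y)"
    have "u * (x / d + (- y / d) * b) = (u * (x - y * b)) / d" for d
      by (simp add: diff_divide_distrib right_diff_distrib mult.commute)
    then have "u * (x / ?d + (- y / ?d) * b) = (u * (x - y * b)) / ?d" .
    also have "\<dots> = 1" using eq nz by simp
    finally have "inverse u = x / ?d + (- y / ?d) * b" by (rule inverse_unique)
    also have "\<dots> \<in> T" by (intro T div closed u a)
    finally show ?thesis .
  qed (use uT in simp)
  have sosT: "\<exists>s\<in>sos_in S. \<exists>t\<in>sos_in S. \<exists>v\<in>S. z = s + a * t + v * b" if "z \<in> sos_in T" for z
    using that
  proof induction
    case (add u z)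
    then obtain s t v where z: "s \<in> sos_in S" "t \<in> sos_in S" "v \<in> S" "z = s + a * t + v * b" by blast
    obtain x y where u: "u = x + y * b" "x \<in> S" "y \<in> S" using add by (auto simp: T_def)
    have "u * u + z = (x * x + s) + (b * b) * (y * y + t) + (x * y + x * y + v) * b"
      unfolding u z a(1)[symmetric] by (simp add: algebra_simps)
    moreover have "x * y + x * y + v \<in> S" using u z by (intro closed)
    ultimately show ?case using u z unfolding a(1) by (blast intro: sos_in.add)
  qed (use closed(1) sos_in.zero[of S] in force)
  have "- 1 \<notin> sos_in T"
  proof
    assume "- 1 \<in> sos_in T"
    then obtain s t v where z: "s \<in> sos_in S" "t \<in> sos_in S" "v \<in> S" "- 1 = s + a * t + v * b" using sosT by blast
    have st: "s \<in> S" "t \<in> S" using sos_in_subset[OF sub] z by auto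
    have v: "v * b = - (1 + s + a * t)" using z(4) by (simp add: algebra_simps eq_neg_iff_add_eq_0)
    show False
    proof (cases "v = 0")
      case True
      with v have "- (1 + s + a * t) = 0" by simp
      then show False using nonzero[OF z(1,2)] by (simp only: neg_equal_0_iff_equal)
    next
      case v0: False
      then have "b = (- (1 + s + a * t)) / v" using v by (simp add: field_simps)
      moreover have "\<dots> \<in> S" by (intro div closed st a z)
      ultimately show False using False by simp
    qed
  qed
  then show ?thesis using subT invT ST bT by (auto simp: real_subfield_def)
qed (use S in blast)

text \<open>A sum of squares involves finitely many elements, which all lie in one member of the
  chain.\<close>

lemma sos_in_chain_Union:
  assumes "x \<in> sos_in (\<Union>C)" "subset.chain A C" "C \<noteq> {}"
  shows "\<exists>S\<in>C. x \<in> sos_in S"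
  using assms(1)
proof induction
  case (add x y)
  then obtain S T where ST: "S \<in> C" "y \<in> sos_in S" "T \<in> C" "x \<in> T" by blast
  then consider "S \<subseteq> T" | "T \<subseteq> S" using assms(2) by (meson subset_chain_def)
  then show ?case
    using ST by cases (blast intro: sos_in.add sos_in_mono)+
qed (use assms(3) sos_in.zero in blast)

lemma real_subfield_maximal:
  assumes "real_subfield S"
  shows "\<exists>R. real_subfield R \<and> S \<subseteq> R \<and> (\<forall>T. real_subfield T \<longrightarrow> R \<subseteq> T \<longrightarrow> T = R)"
proof -
  let ?A = "{R. real_subfield R \<and> S \<subseteq> R}"
  have "\<exists>R\<in>?A. \<forall>T\<in>?A. R \<subseteq> T \<longrightarrow> T = R"
  proof (rule subset_Zorn_nonempty)
    show "?A \<noteq> {}" using assms by blast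
    fix C assume C: "C \<noteq> {}" "subset.chain ?A C"
    then have CA: "\<And>T. T \<in> C \<Longrightarrow> real_subfield T \<and> S \<subseteq> T" by (auto simp: subset_chain_def)
    have "subring_set (\<Union>C)"
      unfolding subring_set_def
    proof (intro conjI ballI)
      show "1 \<in> \<Union>C" using C(1) CA by (force simp: real_subfield_def subring_set_def)
      fix x y assume "x \<in> \<Union>C" "y \<in> \<Union>C"
      then obtain T U where "T \<in> C" "x \<in> T" "U \<in> C" "y \<in> U" by blast
      moreover from this have "T \<subseteq> U \<or> U \<subseteq> T" using C(2) by (meson subset_chain_def)
      ultimately obtain W where "W \<in> C" "x \<in> W" "y \<in> W" by blast
      moreover from this have "x - y \<in> W" "x * y \<in> W"
        using CA[of W] by (auto simp: real_subfield_def subring_set_def)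
      ultimately show "x - y \<in> \<Union>C" "x * y \<in> \<Union>C" by blast+
    qed
    moreover have "inverse x \<in> \<Union>C" if "x \<in> \<Union>C" for x
      using that CA by (force simp: real_subfield_def)
    moreover have "- 1 \<notin> sos_in (\<Union>C)"
      using sos_in_chain_Union[OF _ C(2,1)] CA by (force simp: real_subfield_def)
    moreover have "S \<subseteq> \<Union>C" using C(1) CA by blast
    ultimately show "\<Union>C \<in> ?A" by (auto simp: real_subfield_def)
  qed
  then show ?thesis by (metis (no_types, lifting) mem_Collect_eq order_trans)
qed

text \<open>If no square root of \<open>a\<close> can be adjoined, then
  \<open>1 + s + a * t = 0\<close> for sums of squares \<open>s\<close>, \<open>t\<close>, and
  solving for \<open>- a\<close> shows that it is a sum of squares. A sum of squares in
  \<open>R\<close> always has a root in \<open>R\<close>, because for it such an equation would make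
  \<open>- 1\<close> a sum of squares.\<close>

lemma maximal_real_subfield_sqrt:
  fixes R :: "'a::alg_closed_field set"
  assumes R: "real_subfield R" and max: "\<And>T. real_subfield T \<Longrightarrow> R \<subseteq> T \<Longrightarrow> T = R"
    and "a \<in> R"
  shows "\<exists>b\<in>R. b * b = a \<or> b * b = - a"
proof -
  have sub: "subring_set R" using R by (simp add: real_subfield_def)
  have m1: "- 1 \<notin> sos_in R" using R by (simp add: real_subfield_def)
  have root: "\<exists>b\<in>R. b * b = a"
    if "a \<in> R" "\<And>s t. s \<in> sos_in R \<Longrightarrow> t \<in> sos_in R \<Longrightarrow> 1 + s + a * t \<noteq> 0" for a
  proof -
    obtain b where b: "b ^ 2 = a" using nth_root_exists[of 2 a] by auto
    then have "b * b = a" by (simp add: power2_eq_square)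
    from real_subfield_adjoin_sqrt[OF R this that(1)] that(2) obtain T where
      "real_subfield T" "R \<subseteq> T" "b \<in> T" by blast
    then have "b \<in> R" using max by blast
    then show ?thesis using \<open>b * b = a\<close> by blast
  qed
  have sos: "\<exists>b\<in>R. b * b = a" if "a \<in> sos_in R" for a
  proof (rule root)
    show "a \<in> R" using sos_in_subset[OF sub that] .
    fix s t assume "s \<in> sos_in R" "t \<in> sos_in R"
    then have "s + a * t \<in> sos_in R" using that by (intro sos_in_add sos_in_mult[OF sub])
    then show "1 + s + a * t \<noteq> 0" using m1
      by (metis add.assoc eq_neg_iff_add_eq_0 add.commute)
  qed
  show ?thesis
  proof (cases "\<exists>s\<in>sos_in R. \<exists>t\<in>sos_in R. 1 + s + a * t = 0")
    case False
    then show ?thesis using root[OF \<open>a \<in> R\<close>] by blast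
  next
    case True
    then obtain s t where st: "s \<in> sos_in R" "t \<in> sos_in R" "1 + s + a * t = 0" by blast
    have "t \<noteq> 0" using st m1 by (metis add.commute add.right_neutral eq_neg_iff_add_eq_0 mult_zero_right)
    have "inverse t \<in> R" using sos_in_subset[OF sub st(2)] R by (simp add: real_subfield_def)
    have "- a * t = 1 + s" using st(3) by (simp add: eq_neg_iff_add_eq_0 add.commute neg_eq_iff_add_eq_0)
    then have "- a = (1 + s) * t * (inverse t * inverse t)" using \<open>t \<noteq> 0\<close> by (simp add: field_simps)
    moreover have "(1 + s) * t * (inverse t * inverse t) \<in> sos_in R"
      using st \<open>inverse t \<in> R\<close> sos_in_square[OF subring_one[OF sub]]
      by (intro sos_in_mult[OF sub] sos_in_add sos_in_square) auto
    ultimately show ?thesis using sos by metis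
  qed
qed

text \<open>For a root \<open>e\<close> of a counterexample \<open>p\<close> of least degree, the field generated by \<open>e\<close> is again real: if
  \<open>1 + w(e) = 0\<close> with \<open>w\<close> a sum of squares of polynomials of degree less than \<open>degree p\<close>, then \<open>1 + w = p k\<close>, where
  \<open>k\<close> changes sign together with \<open>p\<close>, has smaller degree and hence has a root, at which \<open>1 + w\<close> would vanish.\<close>

lemma maximal_real_subfield_sign_change:
  fixes h :: "'a::linordered_field \<Rightarrow> 'b::alg_closed_field" and p :: "'a poly"
  assumes "comm_ring_hom h" and max: "\<And>S. real_subfield S \<Longrightarrow> range h \<subseteq> S \<Longrightarrow> S = range h"
    and "a < b" "poly p a * poly p b < 0"
  shows "\<exists>x. a < x \<and> x < b \<and> poly p x = 0"
  using assms(4)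
proof (induction "degree p" arbitrary: p rule: less_induct)
  case less
  interpret comm_ring_hom h by fact
  show ?case
  proof (rule ccontr)
    assume noroot: "\<not> ?thesis"
    \<comment> \<open>A sign change of a product is a sign change of a factor, and a proper factor
      has a root by the induction hypothesis.\<close>
    have factor: "degree q = 0 \<or> degree r = 0" if qr: "p = q * r" for q r
    proof (rule ccontr)
      assume deg: "\<not> ?thesis"
      have "p \<noteq> 0" using less.prems by auto
      then have "degree p = degree q + degree r" unfolding qr by (intro degree_mult_eq) auto
      then have lt: "degree q < degree p" "degree r < degree p" using deg by auto
      have "poly p a * poly p b = (poly q a * poly q b) * (poly r a * poly r b)" unfolding qr by simp
      then consider "poly q a * poly q b < 0" | "poly r a * poly r b < 0"
        using less.prems by (metis mult_less_0_iff)
      then show False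
        using less.hyps[OF lt(1)] less.hyps[OF lt(2)] noroot unfolding qr by cases auto
    qed
    have h_nz: "h x \<noteq> 0" if "x \<noteq> 0" for x
    proof
      assume "h x = 0"
      then have "h (x * inverse x) = 0" by (simp add: hom_mult)
      then show False using that by (simp add: hom_one)
    qed
    have "degree p > 0"
    proof (rule ccontr)
      assume "\<not> ?thesis"
      then obtain c where "p = [:c:]" by (auto elim: degree_eq_zeroE)
      then show False using less.prems by (simp add: not_less[symmetric])
    qed
    then have "degree (map_poly h p) > 0" by (subst degree_map_poly) (auto simp: h_nz)
    then obtain e where e: "poly (map_poly h p) e = 0" using alg_closed_imp_poly_has_root by blast
    define val where "val g = poly (map_poly h g) e" for g
    interpret val: comm_ring_hom val
      unfolding val_def by standard (simp_all add: map_poly_hom_add map_poly_hom_mult one_pCons hom_one map_poly_pCons)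
    have val_const: "val [:c:] = h c" for c by (simp add: val_def map_poly_pCons)
    have "p \<noteq> 0" using less.prems by auto
    \<comment> \<open>A minimal polynomial of \<open>e\<close>; by \<open>factor\<close> it agrees
      with \<open>p\<close> up to a constant.\<close>
    then obtain m where m: "m \<noteq> 0" "val m = 0" "\<And>g. g \<noteq> 0 \<Longrightarrow> val g = 0 \<Longrightarrow> degree m \<le> degree g"
      using ex_has_least_nat[of "\<lambda>g. g \<noteq> 0 \<and> val g = 0" p degree] e by (auto simp: val_def)
    have mod_less: "g mod f = 0 \<or> degree (g mod f) < degree f" if "f \<noteq> 0" for f g :: "'a poly"
      using degree_mod_less[OF that] by auto
    have val_mod: "val (g mod m) = val g" for g
    proof -
      have "val g = val (m * (g div m) + g mod m)" by simp
      then show ?thesis unfolding val.hom_add val.hom_mult by (simp add: m(2))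
    qed
    have m_dvd: "m dvd g" if "val g = 0" for g
    proof -
      have "g mod m = 0" using m(3)[of "g mod m"] mod_less[OF m(1), of g] that val_mod[of g] by (metis leD)
      then show ?thesis by (simp add: dvd_eq_mod_eq_0)
    qed
    have "val p = 0" using e by (simp add: val_def)
    then obtain u where u: "p = m * u" using m_dvd by blast
    have deg_m: "degree m \<noteq> 0"
    proof
      assume "degree m = 0"
      then obtain c where "m = [:c:]" by (auto elim: degree_eq_zeroE)
      then show False using m h_nz by (auto simp: val_const)
    qed
    then have "degree u = 0" using factor[OF u] by simp
    have "u \<noteq> 0" using less.prems u by auto
    then have deg_p: "degree p = degree m" using u m(1) \<open>degree u = 0\<close> by (simp add: degree_mult_eq)
    obtain c where c: "u = [:c:]" using \<open>degree u = 0\<close> by (auto elim: degree_eq_zeroE)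
    have m_sign: "poly m a * poly m b < 0"
    proof -
      have "poly p a * poly p b = (c * c) * (poly m a * poly m b)" unfolding u c by simp
      then show ?thesis using less.prems by (auto simp: mult_less_0_iff)
    qed
    have "real_subfield (range val)"
      unfolding real_subfield_def
    proof (intro conjI ballI)
      show "subring_set (range val)"
        unfolding subring_set_def by (auto simp flip: val.hom_diff val.hom_mult val.hom_one)
    next
      fix x assume "x \<in> range val"
      then obtain g where g: "x = val g" by blast
      show "inverse x \<in> range val"
      proof (cases "x = 0")
        case False
        \<comment> \<open>\<open>I\<close> collects the representatives of nonzero multiples of
          \<open>val g\<close>. Dividing \<open>m\<close> by one of least degree shows that this
          degree is 0, which makes \<open>val g\<close> invertible.\<close>
        define I where "I f \<longleftrightarrow> val f \<noteq> 0 \<and> (\<exists>k. val f = val g * val k)" for f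
        have "I g" using False unfolding I_def g by (intro conjI exI[of _ 1]) (simp_all add: val.hom_one)
        then obtain f where f: "I f" "\<And>f'. I f' \<Longrightarrow> degree f \<le> degree f'"
          using ex_has_least_nat[of I g degree] by blast
        then obtain k where k: "val f \<noteq> 0" "val f = val g * val k" by (auto simp: I_def)
        have "degree f = 0"
        proof (rule ccontr)
          assume "degree f \<noteq> 0"
          have "I (f mod m)" using k unfolding I_def val_mod by blast
          then have "degree f < degree m" using f(2) mod_less[OF m(1), of f]
            by (metis I_def le_less_trans val.hom_zero)
          have "f \<noteq> 0" using k by auto
          have eq: "val f * val (m div f) + val (m mod f) = 0"
            using m(2) by (metis mult_div_mod_eq val.hom_add val.hom_mult)
          show False
          proof (cases "val (m mod f) = 0")
            case True
            then have "m mod f = 0"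
              using m(3)[of "m mod f"] mod_less[OF \<open>f \<noteq> 0\<close>, of m] \<open>degree f < degree m\<close>
              by (metis leD less_trans)
            then have "m = f * (m div f)" by (metis dvd_mult_div_cancel mod_eq_0_iff_dvd)
            moreover have "val (m div f) = 0" using eq True k by simp
            ultimately have "degree m \<le> degree (m div f)" using m by (metis mult_zero_right)
            moreover have "degree m = degree f + degree (m div f)"
              using \<open>m = f * (m div f)\<close> m(1) by (metis degree_mult_eq mult_eq_0_iff)
            ultimately show False using \<open>degree f \<noteq> 0\<close> by simp
          next
            case False
            have "val (m mod f) = val g * val (- (k * (m div f)))"
              using eq unfolding k(2) val.hom_uminus val.hom_mult
              by (simp add: eq_neg_iff_add_eq_0 algebra_simps)
            then have "I (m mod f)" using False unfolding I_def by blast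
            then have "degree f \<le> degree (m mod f)" by (rule f(2))
            moreover have "m mod f \<noteq> 0" using False by auto
            ultimately show False using mod_less[OF \<open>f \<noteq> 0\<close>, of m] by simp
          qed
        qed
        then obtain d where d: "f = [:d:]" by (auto elim: degree_eq_zeroE)
        have "d \<noteq> 0" using k d by auto
        have "val g * val (k * [:inverse d:]) = val (f * [:inverse d:])"
          by (simp only: val.hom_mult k(2) mult.assoc)
        also have "f * [:inverse d:] = 1" using d \<open>d \<noteq> 0\<close> by (simp add: one_pCons)
        finally have "inverse x = val (k * [:inverse d:])"
          unfolding g val.hom_one by (rule inverse_unique)
        then show ?thesis by blast
      qed (metis inverse_zero rangeI val.hom_zero)
    next
      \<comment> \<open>Reduction modulo \<open>m\<close> bounds the degree of every square.
        Nonnegativity at all points is recorded as well, because it makes \<open>1 + w\<close>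
        positive.\<close>
      have rep: "\<exists>w. val w = z \<and> degree w \<le> 2 * (degree m - 1) \<and> (\<forall>x. 0 \<le> poly w x)"
        if "z \<in> sos_in (range val)" for z
        using that
      proof induction
        case zero
        show ?case by (intro exI[of _ 0]) simp
      next
        case (add y z)
        then obtain g w where g: "y = val g" and w: "val w = z" "degree w \<le> 2 * (degree m - 1)" "\<forall>x. 0 \<le> poly w x"
          by blast
        let ?g = "g mod m"
        have "degree ?g \<le> degree m - 1" using mod_less[OF m(1), of g] deg_m by auto
        then have "degree (?g * ?g) \<le> 2 * (degree m - 1)"
          using degree_mult_le[of ?g ?g] by linarith
        then have "degree (?g * ?g + w) \<le> 2 * (degree m - 1)" using w(2) by (intro degree_add_le)
        moreover have "val (?g * ?g + w) = y * y + z"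
          by (simp only: val.hom_add val.hom_mult val_mod g w(1))
        ultimately show ?case using w(3) by (intro exI[of _ "?g * ?g + w"]) simp
      qed
      show "- 1 \<notin> sos_in (range val)"
      proof
        assume "- 1 \<in> sos_in (range val)"
        then obtain w where w: "val w = - 1" "degree w \<le> 2 * (degree m - 1)" "\<And>x. 0 \<le> poly w x"
          using rep by blast
        have "val (1 + w) = 0" by (simp add: val.hom_add val.hom_one w(1))
        then obtain k where k: "1 + w = m * k" using m_dvd by blast
        have pos: "0 < poly (1 + w) x" for x using w(3)[of x] by simp
        then have nz: "1 + w \<noteq> 0" by (metis less_irrefl poly_0)
        have "degree (1 + w) \<le> 2 * (degree m - 1)"
          by (intro degree_add_le w(2)) simp
        moreover have "degree (1 + w) = degree m + degree k"
          using nz unfolding k by (intro degree_mult_eq) auto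
        ultimately have "degree k < degree p" using deg_m deg_p by linarith
        moreover have "poly k a * poly k b < 0"
        proof -
          have "0 < (poly m a * poly k a) * (poly m b * poly k b)"
            using pos[of a] pos[of b] unfolding k by simp
          then have "0 < (poly m a * poly m b) * (poly k a * poly k b)" by (simp add: ac_simps)
          then show ?thesis
            using m_sign zero_less_mult_iff[of "poly m a * poly m b" "poly k a * poly k b"] by linarith
        qed
        ultimately obtain x where "poly k x = 0" using less.hyps by blast
        then have "poly (1 + w) x = 0" unfolding k by simp
        then show False using pos[of x] by simp
      qed
    qed
    moreover have "range h \<subseteq> range val" using val_const by (metis image_subsetI rangeI)
    \<comment> \<open>Maximality puts \<open>e\<close> into \<open>range h\<close>, so
      \<open>p\<close> has a linear factor and, by \<open>factor\<close>, is linear itself; its root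
      must then be the sign change.\<close>
    ultimately have "range val = range h" by (rule max)
    moreover have "val [:0, 1:] = e" by (simp add: val_def map_poly_pCons hom_one)
    ultimately obtain x where x: "e = h x" by (metis imageE rangeI)
    have "h (poly m x) = 0" using m(2) unfolding val_def x poly_map_poly_hom .
    then have "poly m x = 0" using h_nz by blast
    then obtain q where q: "m = [:- x, 1:] * q" using poly_eq_0_iff_dvd[of m x] by blast
    then have "p = [:- x, 1:] * (q * u)" unfolding u by (simp only: q mult.assoc)
    from factor[OF this] obtain d where d: "q * u = [:d:]" by (auto elim: degree_eq_zeroE)
    then have p: "p = [:- x, 1:] * [:d:]" using \<open>p = [:- x, 1:] * (q * u)\<close> by simp
    have "poly p a * poly p b = (d * d) * ((a - x) * (b - x))" unfolding p by (simp add: algebra_simps)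
    then have "(a - x) * (b - x) < 0" using less.prems by (auto simp: mult_less_0_iff)
    then have "a < x" "x < b" using \<open>a < b\<close> by (auto simp: mult_less_0_iff)
    moreover have "poly p x = 0" unfolding p by simp
    ultimately show False using noroot by blast
  qed
qed

section \<open>Hilbert's seventeenth problem\<close>

lemma eval_sos_in_nonneg: "f \<in> sos_in S \<Longrightarrow> 0 \<le> evalp f x"
  by (induction rule: sos_in.induct) (simp_all add: evalp.hom_add evalp.hom_mult)

lemma square_add_sos_in_nonzero:
  fixes d :: "'n::finite mp"
  assumes "s \<in> sos_in S" "d \<noteq> 0"
  shows "d * d + s \<noteq> 0"
proof
  assume eq: "d * d + s = 0"
  obtain a where a: "evalp d a \<noteq> 0" using eval_nonzero_near[OF assms(2) zero_less_one] by blast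
  have "evalp d a * evalp d a + evalp s a = 0"
    using arg_cong[OF eq, of "\<lambda>f. evalp f a"] by (simp add: evalp.hom_add evalp.hom_mult)
  moreover have "0 < evalp d a * evalp d a" using a by (auto simp: zero_less_mult_iff neq_iff)
  ultimately show False using eval_sos_in_nonneg[OF assms(1), of a] by linarith
qed

lemma subring_set_UNIV: "subring_set UNIV"
  by (simp add: subring_set_def)

section \<open>Polynomials without denominator and the field of rational functions\<close>

definition no_denominator :: "'n::finite mp \<Rightarrow> bool" where
  "no_denominator f \<longleftrightarrow> (\<forall>s. s \<noteq> 0 \<longrightarrow> s * s * f \<notin> sos_in UNIV)"

text \<open>Provides a candidate for \<open>bad_poly\<close> even when every positive semidefinite
  polynomial has a denominator.\<close>

lemma no_denominator_m1: "no_denominator (- 1 :: 'n::finite mp)"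
  unfolding no_denominator_def
proof (intro allI impI notI)
  fix s :: "'n mp" assume "s \<noteq> 0" "s * s * - 1 \<in> sos_in UNIV"
  from square_add_sos_in_nonzero[OF this(2,1)] show False by simp
qed

definition emb :: "'n::finite mp \<Rightarrow> 'n mp fract alg_closure" where
  "emb f = to_ac (to_fract f)"

interpretation emb: comm_ring_hom emb
  by standard (simp_all add: emb_def)

lemma emb_eq_0_iff [simp]: "emb f = 0 \<longleftrightarrow> f = 0"
  by (simp add: emb_def)

lemma emb_inj: "emb f = emb g \<Longrightarrow> f = g"
  by (simp add: emb_def)

lemma sos_in_fract:
  fixes z :: "'n::finite mp fract alg_closure"
  assumes "z \<in> sos_in (range to_ac)"
  shows "\<exists>s\<in>sos_in UNIV. \<exists>d. d \<noteq> 0 \<and> z = emb s / (emb d * emb d)"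
  using assms
proof induction
  case zero
  show ?case by (intro bexI[of _ 0] exI[of _ 1]) (auto intro: sos_in.zero)
next
  case (add x z)
  then obtain s d where sd: "s \<in> sos_in UNIV" "d \<noteq> 0" "z = emb s / (emb d * emb d)" by blast
  obtain y where "x = to_ac y" using add by blast
  obtain p q where "y = Fraction_Field.Fract p q" "q \<noteq> 0" by (cases y) auto
  then have x: "x = emb p / emb q" "q \<noteq> 0"
    using \<open>x = to_ac y\<close> by (simp_all add: emb_def Fract_conv_to_fract)
  have "x * x + z = emb ((p * d) * (p * d) + (q * q) * s) / (emb (q * d) * emb (q * d))"
    unfolding x(1) sd(3) using x(2) sd(2) by (simp add: emb.hom_add emb.hom_mult field_simps)
  moreover have "(p * d) * (p * d) + (q * q) * s \<in> sos_in UNIV"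
    by (intro sos_in.add sos_in_mult[OF subring_set_UNIV] sos_in_square sd) auto
  ultimately show ?case using x sd by (metis mult_eq_0_iff)
qed

lemma real_subfield_fract: "real_subfield (range to_ac :: 'n::finite mp fract alg_closure set)"
  unfolding real_subfield_def
proof (intro conjI ballI notI)
  show "subring_set (range to_ac :: 'n mp fract alg_closure set)"
    unfolding subring_set_def by (auto simp flip: to_ac_diff to_ac_mult to_ac_1)
  show "inverse x \<in> range to_ac" if "x \<in> range to_ac" for x :: "'n mp fract alg_closure"
    using that by (auto simp flip: to_ac_inverse)
  assume "(- 1 :: 'n mp fract alg_closure) \<in> sos_in (range to_ac)"
  then obtain s d :: "'n mp" where sd: "s \<in> sos_in UNIV" "d \<noteq> 0" "- 1 = emb s / (emb d * emb d)"
    using sos_in_fract by blast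
  then have "- (emb d * emb d) = emb s" by (simp add: field_simps)
  then have "emb (d * d + s) = 0" unfolding emb.hom_add emb.hom_mult by (metis add.right_inverse)
  then show False using square_add_sos_in_nonzero[OF sd(1,2)] by simp
qed

text \<open>The condition for adjoining a square root of \<open>- f\<close>. Clearing denominators
  in a vanishing expression gives \<open>(d * d + s) * (e * e) = f * t * (d * d)\<close>; multiplied
  by \<open>t\<close>, this makes \<open>t * d\<close> a denominator of \<open>f\<close>.\<close>

lemma no_denominator_nonzero:
  fixes f :: "'n::finite mp"
  assumes "no_denominator f" "x \<in> sos_in (range to_ac)" "y \<in> sos_in (range to_ac)"
  shows "1 + x + emb (- f) * y \<noteq> 0"
proof
  assume eq: "1 + x + emb (- f) * y = 0"
  obtain s d where s: "s \<in> sos_in UNIV" "d \<noteq> 0" "x = emb s / (emb d * emb d)"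
    using sos_in_fract[OF assms(2)] by blast
  obtain t e where t: "t \<in> sos_in UNIV" "e \<noteq> 0" "y = emb t / (emb e * emb e)"
    using sos_in_fract[OF assms(3)] by blast
  have "emb ((d * d + s) * (e * e)) = emb (f * t * (d * d))"
    using eq s t by (simp add: emb.hom_add emb.hom_mult emb.hom_uminus field_simps)
  then have *: "(d * d + s) * (e * e) = f * t * (d * d)" by (rule emb_inj)
  have "t \<noteq> 0" using * square_add_sos_in_nonzero[OF s(1,2)] t by auto
  have "(t * d) * (t * d) * f = t * ((d * d + s) * (e * e))" unfolding * by (simp add: algebra_simps)
  also have "\<dots> \<in> sos_in UNIV"
    using s t by (intro sos_in_mult[OF subring_set_UNIV] sos_in_square sos_in.add) auto
  finally show False using assms(1) \<open>t \<noteq> 0\<close> s(2) unfolding no_denominator_def by (metis mult_eq_0_iff)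
qed

text \<open>A type definition takes no value parameters, hence the polynomial that is to become negative is
  fixed by choice: a positive semidefinite polynomial without Artin denominator, if there is one.\<close>

definition bad_poly :: "'n::finite mp" where
  "bad_poly = (SOME f. no_denominator f \<and>
     ((\<exists>g::'n mp. no_denominator g \<and> (\<forall>x. 0 \<le> evalp g x)) \<longrightarrow> (\<forall>x. 0 \<le> evalp f x)))"

lemma bad_poly:
  shows "no_denominator (bad_poly :: 'n::finite mp)"
    and "no_denominator (g :: 'n mp) \<Longrightarrow> (\<And>x. 0 \<le> evalp g x) \<Longrightarrow> 0 \<le> evalp (bad_poly :: 'n mp) x"
proof -
  have "\<exists>f::'n mp. no_denominator f \<and>
     ((\<exists>g::'n mp. no_denominator g \<and> (\<forall>x. 0 \<le> evalp g x)) \<longrightarrow> (\<forall>x. 0 \<le> evalp f x))"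
    using no_denominator_m1 by blast
  then have "no_denominator (bad_poly :: 'n mp) \<and>
     ((\<exists>g::'n mp. no_denominator g \<and> (\<forall>x. 0 \<le> evalp g x)) \<longrightarrow> (\<forall>x. 0 \<le> evalp (bad_poly :: 'n mp) x))"
    unfolding bad_poly_def by (rule someI_ex)
  then show "no_denominator (bad_poly :: 'n mp)"
    and "no_denominator (g :: 'n mp) \<Longrightarrow> (\<And>x. 0 \<le> evalp g x) \<Longrightarrow> 0 \<le> evalp (bad_poly :: 'n mp) x"
    by blast+
qed

definition rc_set :: "'n::finite mp fract alg_closure set" where
  "rc_set = (SOME R. real_subfield R \<and> range to_ac \<subseteq> R \<and> (\<exists>b\<in>R. b * b = emb (- bad_poly)) \<and>
     (\<forall>T. real_subfield T \<longrightarrow> R \<subseteq> T \<longrightarrow> T = R))"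

lemma rc_set:
  shows "real_subfield (rc_set :: 'n::finite mp fract alg_closure set)"
    and "range to_ac \<subseteq> (rc_set :: 'n mp fract alg_closure set)"
    and "\<exists>b\<in>rc_set. b * b = emb (- bad_poly :: 'n mp)"
    and "real_subfield T \<Longrightarrow> rc_set \<subseteq> T \<Longrightarrow> T = (rc_set :: 'n mp fract alg_closure set)"
proof -
  obtain b where b: "b ^ 2 = emb (- bad_poly :: 'n mp)" using nth_root_exists[of 2] by auto
  have "\<exists>S. real_subfield S \<and> range to_ac \<subseteq> S \<and> b \<in> S"
    by (rule real_subfield_adjoin_sqrt[OF real_subfield_fract b[unfolded power2_eq_square] _
          no_denominator_nonzero[OF bad_poly(1)]]) (simp only: emb_def rangeI)
  then obtain S where S: "real_subfield S" "range to_ac \<subseteq> S" "b \<in> S" by blast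
  obtain R where "real_subfield R" "S \<subseteq> R" "\<forall>T. real_subfield T \<longrightarrow> R \<subseteq> T \<longrightarrow> T = R"
    using real_subfield_maximal[OF S(1)] by blast
  moreover from this S have "range to_ac \<subseteq> R" "b \<in> R" by auto
  moreover have "b * b = emb (- bad_poly)" using b by (simp add: power2_eq_square)
  ultimately have
    "\<exists>R::'n mp fract alg_closure set. real_subfield R \<and> range to_ac \<subseteq> R \<and>
       (\<exists>b\<in>R. b * b = emb (- bad_poly)) \<and> (\<forall>T. real_subfield T \<longrightarrow> R \<subseteq> T \<longrightarrow> T = R)"
    by blast
  then have "real_subfield (rc_set :: 'n mp fract alg_closure set) \<and>
     range to_ac \<subseteq> (rc_set :: 'n mp fract alg_closure set) \<and> (\<exists>b\<in>rc_set. b * b = emb (- bad_poly :: 'n mp)) \<and>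
     (\<forall>T. real_subfield T \<longrightarrow> rc_set \<subseteq> T \<longrightarrow> T = (rc_set :: 'n mp fract alg_closure set))"
    unfolding rc_set_def by (rule someI_ex)
  then show
    "real_subfield (rc_set :: 'n mp fract alg_closure set)"
    "range to_ac \<subseteq> (rc_set :: 'n mp fract alg_closure set)"
    "\<exists>b\<in>rc_set. b * b = emb (- bad_poly :: 'n mp)"
    "real_subfield T \<Longrightarrow> rc_set \<subseteq> T \<Longrightarrow> T = (rc_set :: 'n mp fract alg_closure set)"
    by blast+
qed

lemma subring_set_rc_set: "subring_set rc_set"
  and rc_set_inverse: "x \<in> rc_set \<Longrightarrow> inverse x \<in> rc_set"
  and rc_set_m1: "- 1 \<notin> sos_in rc_set"
  using rc_set(1) by (auto simp: real_subfield_def)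

text \<open>Classes such as \<open>real_closed_field\<close> concern types, so the chosen subfield
  has to become a type before \<open>sign_transfer\<close> applies to it.\<close>

typedef (overloaded) 'n::finite rc = "rc_set :: 'n mp fract alg_closure set"
  using subring_one[OF subring_set_rc_set] by blast

setup_lifting type_definition_rc

instantiation rc :: (finite) field
begin

lift_definition zero_rc :: "'a rc" is 0 by (rule subring_zero[OF subring_set_rc_set])
lift_definition one_rc :: "'a rc" is 1 by (rule subring_one[OF subring_set_rc_set])
lift_definition plus_rc :: "'a rc \<Rightarrow> 'a rc \<Rightarrow> 'a rc" is "(+)" by (rule subring_add[OF subring_set_rc_set])
lift_definition minus_rc :: "'a rc \<Rightarrow> 'a rc \<Rightarrow> 'a rc" is "(-)" by (rule subring_diff[OF subring_set_rc_set])
lift_definition uminus_rc :: "'a rc \<Rightarrow> 'a rc" is uminus by (rule subring_uminus[OF subring_set_rc_set])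
lift_definition times_rc :: "'a rc \<Rightarrow> 'a rc \<Rightarrow> 'a rc" is "(*)" by (rule subring_mult[OF subring_set_rc_set])
lift_definition inverse_rc :: "'a rc \<Rightarrow> 'a rc" is inverse by (rule rc_set_inverse)
lift_definition divide_rc :: "'a rc \<Rightarrow> 'a rc \<Rightarrow> 'a rc" is "\<lambda>x y. x * inverse y"
  by (intro subring_mult[OF subring_set_rc_set] rc_set_inverse)

instance
  by standard (transfer; simp add: algebra_simps)+

end

section \<open>The ordering of the maximal real subfield\<close>

lemma sos_in_Rep_rc: "x \<in> sos_in UNIV \<Longrightarrow> Rep_rc x \<in> sos_in rc_set"
proof (induction rule: sos_in.induct)
  case (add x y)
  then show ?case using sos_in.add[OF Rep_rc[of x]] by (simp add: plus_rc.rep_eq times_rc.rep_eq)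
qed (simp add: zero_rc.rep_eq sos_in.zero)

lemma rc_m1: "(- 1 :: 'n::finite rc) \<notin> sos_in UNIV"
  using sos_in_Rep_rc[of "- 1"] rc_set_m1 by (auto simp: uminus_rc.rep_eq one_rc.rep_eq)

lemma rc_sqrt: "\<exists>y. y * y = (x :: 'n::finite rc) \<or> y * y = - x"
proof -
  obtain b where "b \<in> rc_set" "b * b = Rep_rc x \<or> b * b = - Rep_rc x"
    using maximal_real_subfield_sqrt[OF rc_set(1,4) Rep_rc[of x]] by blast
  then show ?thesis
    by (intro exI[of _ "Abs_rc b"]) (auto simp: Rep_rc_inject[symmetric] times_rc.rep_eq uminus_rc.rep_eq Abs_rc_inverse)
qed

lemma rc_square_add_eq_0:
  fixes x :: "'n::finite rc"
  assumes "x * x + y = 0" "y \<in> sos_in UNIV"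
  shows "x = 0"
proof (rule ccontr)
  assume "x \<noteq> 0"
  have "y = - (x * x)" using assms(1) by (simp add: eq_neg_iff_add_eq_0 add.commute)
  then have "- 1 = (inverse x * inverse x) * y" using \<open>x \<noteq> 0\<close> by (simp add: field_simps)
  also have "\<dots> \<in> sos_in UNIV"
    by (intro sos_in_mult[OF subring_set_UNIV] sos_in_square assms) auto
  finally show False using rc_m1 by blast
qed

lemma rc_square_if_sos:
  fixes x :: "'n::finite rc"
  assumes "x \<in> sos_in UNIV"
  shows "\<exists>y. x = y * y"
proof -
  obtain y where y: "y * y = x \<or> y * y = - x" using rc_sqrt by blast
  show ?thesis
  proof (cases "y * y = x")
    case False
    then have "y * y + x = 0" using y by simp
    then have "y = 0" using rc_square_add_eq_0 assms by blast
    then show ?thesis using y by (intro exI[of _ 0]) auto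
  qed auto
qed

instantiation rc :: (finite) linordered_field
begin

text \<open>The only possible ordering: every element or its negative is a square, and sums of
  squares are squares, so the squares form a positive cone.\<close>

definition less_eq_rc :: "'a rc \<Rightarrow> 'a rc \<Rightarrow> bool" where
  "less_eq_rc x y \<longleftrightarrow> (\<exists>z. y - x = z * z)"
definition less_rc :: "'a rc \<Rightarrow> 'a rc \<Rightarrow> bool" where
  "less_rc x y \<longleftrightarrow> x \<le> y \<and> x \<noteq> y"
definition abs_rc :: "'a rc \<Rightarrow> 'a rc" where
  "abs_rc x = (if x < 0 then - x else x)"
definition sgn_rc :: "'a rc \<Rightarrow> 'a rc" where
  "sgn_rc x = (if x = 0 then 0 else if 0 < x then 1 else - 1)"

instance
proof
  fix x y z :: "'a rc"
  have antisym: "x = y" if "x \<le> y" "y \<le> x" for x y :: "'a rc"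
  proof -
    obtain u v where uv: "y - x = u * u" "x - y = v * v" using \<open>x \<le> y\<close> \<open>y \<le> x\<close> unfolding less_eq_rc_def by blast
    have "u * u + v * v = 0" by (simp flip: uv)
    then have "u = 0" using rc_square_add_eq_0 sos_in_square[of v UNIV] by blast
    then show "x = y" using uv by simp
  qed
  then show "x = y" if "x \<le> y" "y \<le> x" using that by blast
  show "x < y \<longleftrightarrow> x \<le> y \<and> \<not> y \<le> x"
    using antisym unfolding less_rc_def by (auto simp: less_eq_rc_def intro: exI[of _ 0])
  show "x \<le> x" unfolding less_eq_rc_def by (intro exI[of _ 0]) simp
  show "x \<le> z" if xyz: "x \<le> y" "y \<le> z"
  proof -
    obtain u v where uv: "y - x = u * u" "z - y = v * v" using xyz unfolding less_eq_rc_def by blast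
    have "u * u + v * v \<in> sos_in UNIV" by (intro sos_in.add sos_in_square) auto
    moreover have "z - x = u * u + v * v" by (simp flip: uv)
    ultimately show ?thesis unfolding less_eq_rc_def using rc_square_if_sos by metis
  qed
  show "x \<le> y \<or> y \<le> x"
    unfolding less_eq_rc_def using rc_sqrt[of "x - y"] by (metis minus_diff_eq)
  show "z + x \<le> z + y" if "x \<le> y" using that unfolding less_eq_rc_def by simp
  show "z * x < z * y" if xyz: "x < y" "0 < z"
  proof -
    obtain u v where uv: "y - x = u * u" "z - 0 = v * v" using xyz unfolding less_rc_def less_eq_rc_def by blast
    have "z * y - z * x = (u * v) * (u * v)" using uv by (simp add: algebra_simps flip: right_diff_distrib)
    then have "z * x \<le> z * y" unfolding less_eq_rc_def by blast
    then show ?thesis using xyz unfolding less_rc_def by auto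
  qed
qed (auto simp: abs_rc_def sgn_rc_def)

end

instance rc :: (finite) real_closed_field
proof
  fix a b :: "'a rc" and n and f :: "nat \<Rightarrow> 'a rc"
  let ?p = "\<Sum>k\<le>n. monom (f k) k"
  assume "a < b" "(\<Sum>k\<le>n. f k * a ^ k) < 0" "0 < (\<Sum>k\<le>n. f k * b ^ k)"
  then have ab: "a < b" "poly ?p a * poly ?p b < 0" by (simp_all add: poly_sum_monom mult_neg_pos)
  have "comm_ring_hom (Rep_rc :: 'a rc \<Rightarrow> _)"
    by standard (simp_all add: plus_rc.rep_eq times_rc.rep_eq one_rc.rep_eq)
  moreover have "range Rep_rc = (rc_set :: 'a mp fract alg_closure set)"
    using type_definition.Rep_range[OF type_definition_rc] .
  ultimately show "\<exists>x. a < x \<and> x < b \<and> (\<Sum>k\<le>n. f k * x ^ k) = 0"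
    using maximal_real_subfield_sign_change[OF _ _ ab] rc_set(4) unfolding poly_sum_monom by metis
qed

text \<open>Evaluation at the generic point, whose coordinates are
  \<open>generic (Var k)\<close>.\<close>

definition generic :: "'n::finite mp \<Rightarrow> 'n rc" where
  "generic f = Abs_rc (emb f)"

lemma Rep_generic: "Rep_rc (generic f) = emb f"
  unfolding generic_def by (rule Abs_rc_inverse) (use rc_set(2) in \<open>auto simp: emb_def\<close>)

interpretation generic: comm_ring_hom generic
  by standard (simp_all add: Rep_rc_inject[symmetric] Rep_generic plus_rc.rep_eq times_rc.rep_eq one_rc.rep_eq
      emb.hom_add emb.hom_mult emb.hom_one)

lemma generic_eq_0_iff [simp]: "generic f = 0 \<longleftrightarrow> f = 0"
  by (simp add: Rep_rc_inject[symmetric] Rep_generic zero_rc.rep_eq)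

lemma generic_bad_poly_neg: "generic bad_poly < (0 :: 'n::finite rc)"
proof -
  obtain b where b: "b \<in> rc_set" "b * b = emb (- bad_poly :: 'n mp)" using rc_set(3) by blast
  have "generic (- bad_poly) = Abs_rc b * (Abs_rc b :: 'n rc)"
    using b by (simp add: Rep_rc_inject[symmetric] Rep_generic times_rc.rep_eq Abs_rc_inverse)
  then have "0 \<le> - generic (bad_poly :: 'n mp)" by (simp add: generic.hom_uminus)
  moreover have "bad_poly \<noteq> (0 :: 'n mp)"
    using bad_poly(1) sos_in.zero unfolding no_denominator_def by (metis mult_zero_right one_neq_zero)
  ultimately show ?thesis by (simp add: order.order_iff_strict)
qed

text \<open>A point of \<open>\<real>\<^sup>n\<close> is found coordinate by coordinate: one application of \<open>sign_transfer\<close> adjusts the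
  coordinate \<open>k\<close>, given a point that has the right signs for the polynomials not involving \<open>k\<close>.\<close>

lemma generic_specialization:
  fixes G :: "'n::finite mp set"
  assumes "finite G"
  shows "\<exists>a. \<forall>g\<in>G. same_sign (generic g) (evalp g a)"
proof -
  have "\<forall>G\<subseteq>polys_in V. finite G \<longrightarrow> (\<exists>a. \<forall>g\<in>G. same_sign (generic g) (evalp g a))" for V :: "'n set"
    using finite[of V]
  proof (induction V)
    case empty
    have "same_sign (generic g) (evalp g a)" if g0: "g \<in> polys_in {}" for g :: "'n mp" and a
    proof -
      obtain c where g: "g = Const c" using polys_in_empty[OF g0] by blast
      \<comment> \<open>A positive constant is the square of a nonzero constant, hence positive
        under \<open>generic\<close>.\<close>
      have pos: "0 < (generic (Const c) :: 'n rc)" if "0 < c" for c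
      proof -
        have "Const c = Const (sqrt c) * (Const (sqrt c) :: 'n mp)"
          using that by (simp flip: Const.hom_mult)
        moreover have "generic (Const (sqrt c)) \<noteq> (0 :: 'n rc)"
          using that evalp.hom_zero eval_Const by (metis generic_eq_0_iff less_irrefl real_sqrt_gt_zero)
        ultimately show ?thesis
          by (simp add: generic.hom_power del: generic_eq_0_iff flip: power2_eq_square)
      qed
      show ?thesis
        using pos[of c] pos[of "- c"] unfolding g
        by (cases c "0::real" rule: linorder_cases) (auto simp: same_sign_def Const.hom_uminus generic.hom_uminus)
    qed
    then show ?case by blast
  next
    case (insert k V)
    show ?case
    proof (intro allI impI)
      fix G :: "'n mp set" assume G: "G \<subseteq> polys_in (insert k V)" "finite G"
      have "coeff p i \<in> polys_in V" if p: "p \<in> as_poly k ` G" for p i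
      proof -
        obtain f where "f \<in> G" "p = as_poly k f" using p by blast
        then show ?thesis using coeff_as_poly[of f "insert k V" k i] G(1) insert(2) by auto
      qed
      then obtain H where H: "H \<subseteq> polys_in V" "finite H"
        "\<And>(\<phi> :: 'n mp \<Rightarrow> 'n rc) (\<psi> :: 'n mp \<Rightarrow> real) t. comm_ring_hom \<phi> \<Longrightarrow> comm_ring_hom \<psi> \<Longrightarrow>
          (\<forall>g\<in>H. same_sign (\<phi> g) (\<psi> g)) \<Longrightarrow>
          (\<exists>u. \<forall>f\<in>as_poly k ` G. same_sign (poly (map_poly \<phi> f) t) (poly (map_poly \<psi> f) u))"
        using sign_transfer[OF subring_set_polys_in finite_imageI[OF G(2)], of "as_poly k" V] by metis
      obtain a where a: "\<forall>g\<in>H. same_sign (generic g) (evalp g a)" using insert.IH H(1,2) by blast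
      \<comment> \<open>The coordinate \<open>generic (Var k)\<close> is traded for a real number
        \<open>u\<close>.\<close>
      from H(3)[OF generic.comm_ring_hom_axioms evalp.comm_ring_hom_axioms this, of "generic (Var k)"]
      obtain u where u: "\<And>f. f \<in> G \<Longrightarrow> same_sign (poly (map_poly generic (as_poly k f)) (generic (Var k)))
          (poly (map_poly (\<lambda>c. evalp c a) (as_poly k f)) u)" by blast
      have "same_sign (generic f) (evalp f (\<chi> i. if i = k then u else a $ i))" if "f \<in> G" for f
        using u[OF that] unfolding eval_as_poly generic.poly_map_poly_hom poly_as_poly .
      then show "\<exists>a. \<forall>g\<in>G. same_sign (generic g) (evalp g a)" by blast
    qed
  qed
  from this[of UNIV] show ?thesis using assms polys_in_UNIV by blast
qed

text \<open>If \<open>f\<close> had no denominator, \<open>bad_poly\<close> would be positive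
  semidefinite like \<open>f\<close>, yet its negative sign at the generic point reappears at a real
  point.\<close>

theorem hilbert17:
  fixes f :: "'n::finite mp"
  assumes "\<And>x. 0 \<le> evalp f x"
  shows "\<exists>s. s \<noteq> 0 \<and> s * s * f \<in> sos_in UNIV"
proof (rule ccontr)
  assume "\<not> ?thesis"
  then have "no_denominator f" unfolding no_denominator_def by blast
  obtain a where "same_sign (generic (bad_poly :: 'n mp)) (evalp (bad_poly :: 'n mp) a)"
    using generic_specialization[of "{bad_poly :: 'n mp}"] by auto
  then have "evalp (bad_poly :: 'n mp) a < 0" using generic_bad_poly_neg[where 'n = 'n] by (simp add: same_sign_def)
  then show False using bad_poly(2)[OF \<open>no_denominator f\<close> assms, of a] by simp
qed

section \<open>Irreducible polynomials are prime\<close>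

lemma degree_as_poly_mult:
  "f \<noteq> 0 \<Longrightarrow> g \<noteq> 0 \<Longrightarrow> degree (as_poly k (f * g)) = degree (as_poly k f) + degree (as_poly k g)"
  by (simp add: as_poly.hom_mult degree_mult_eq)

lemma polys_in_if_degree_0:
  assumes "f \<in> polys_in V" "degree (as_poly k f) = 0"
  shows "f \<in> polys_in (V - {k})"
proof -
  obtain c where "as_poly k f = [:c:]" using assms(2) by (rule degree_eq_zeroE)
  then show ?thesis using poly_as_poly[of k f] coeff_as_poly[OF assms(1), of k 0] by simp
qed

text \<open>Degrees in each variable add up under products, so a factor cannot contain a variable
  that is absent from a nonzero product.\<close>

lemma polys_in_factor:
  fixes c :: "'n::finite mp"
  assumes "c \<in> polys_in V" "c \<noteq> 0" "d dvd c"
  shows "d \<in> polys_in V"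
proof -
  obtain e where e: "c = d * e" using assms(3) by blast
  then have nz: "d \<noteq> 0" "e \<noteq> 0" using assms(2) by auto
  have deg: "degree (as_poly k d) = 0" if "k \<notin> V" for k
  proof -
    have "degree (as_poly k c) = 0" using as_poly_const[OF assms(1) that] by simp
    then show ?thesis using degree_as_poly_mult[OF nz, of k] by (simp flip: e)
  qed
  have "d \<in> polys_in (UNIV - W)" if "W \<subseteq> - V" for W
    using finite[of W] that
  proof (induction W)
    case empty
    show ?case using polys_in_UNIV by simp
  next
    case (insert k W)
    have "d \<in> polys_in (UNIV - W)" by (rule insert.IH) (use insert.prems in blast)
    moreover have "degree (as_poly k d) = 0" by (rule deg) (use insert.prems in blast)
    ultimately show ?case unfolding Diff_insert[of UNIV k W] by (rule polys_in_if_degree_0)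
  qed
  from this[of "- V"] show ?thesis by (simp add: Diff_eq)
qed

lemma poly_Var_polys_in:
  assumes "\<And>i. coeff s i \<in> polys_in V"
  shows "poly s (Var k) \<in> polys_in (insert k V)"
  using assms
proof (induction s)
  case (pCons c s)
  have "coeff s i \<in> polys_in V" for i using pCons.prems[of "Suc i"] by simp
  moreover have "c \<in> polys_in (insert k V)" using pCons.prems[of 0] polys_in_mono[of c V "insert k V"] by auto
  ultimately show ?case using pCons.IH by (auto intro: polys_in.intros)
qed (simp add: subring_zero[OF subring_set_polys_in])

lemma as_poly_poly_Var:
  assumes "\<And>i. coeff s i \<in> polys_in V" "k \<notin> V"
  shows "as_poly k (poly s (Var k)) = s"
  using assms(1)
proof (induction s)
  case (pCons c s)
  have "coeff s i \<in> polys_in V" for i using pCons.prems[of "Suc i"] by simp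
  moreover have "c \<in> polys_in V" using pCons.prems[of 0] by simp
  ultimately show ?case using pCons.IH as_poly_const[OF _ assms(2)]
    by (simp add: as_poly.hom_add as_poly.hom_mult as_poly_Var)
qed simp

lemma ex_irreducible_factor:
  fixes c :: "'n::finite mp"
  assumes "c \<noteq> 0" "tdeg c \<noteq> 0"
  shows "\<exists>p. irreducible p \<and> p dvd c"
  using assms
proof (induction "tdeg c" arbitrary: c rule: less_induct)
  case less
  show ?case
  proof (cases "irreducible c")
    case False
    moreover have "\<not> c dvd 1" using less.prems by (simp add: dvd_1_iff_tdeg)
    ultimately obtain a b where ab: "c = a * b" "\<not> a dvd 1" "\<not> b dvd 1"
      using less.prems(1) unfolding Factorial_Ring.irreducible_def by blast
    then have nz: "a \<noteq> 0" "b \<noteq> 0" using less.prems by auto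
    then have "tdeg a \<noteq> 0" "tdeg b \<noteq> 0" using ab by (auto simp: dvd_1_iff_tdeg)
    then obtain p where "irreducible p" "p dvd a"
      using less.hyps[of a] tdeg_mult[OF nz] nz by (auto simp: ab(1))
    then show ?thesis using ab(1) by (auto intro: dvd_mult2)
  qed auto
qed

definition primes_in :: "'n::finite set \<Rightarrow> bool" where
  "primes_in V \<longleftrightarrow> (\<forall>p\<in>polys_in V. irreducible p \<longrightarrow>
     (\<forall>f\<in>polys_in V. \<forall>g\<in>polys_in V. p dvd f * g \<longrightarrow> p dvd f \<or> p dvd g))"

context
  fixes V :: "'n::finite set" and k
  assumes V: "primes_in V" and k: "k \<notin> V"
begin

lemma dvd_iff_dvd_coeffs:
  assumes "p \<in> polys_in V"
  shows "p dvd f \<longleftrightarrow> (\<forall>i. p dvd coeff (as_poly k f) i)"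
proof -
  have "p dvd f \<longleftrightarrow> [:p:] dvd as_poly k f"
  proof
    assume "p dvd f"
    then show "[:p:] dvd as_poly k f"
      using as_poly_const[OF assms k] as_poly.hom_mult by (metis dvdE dvd_triv_left)
  next
    assume "[:p:] dvd as_poly k f"
    then obtain q where "as_poly k f = [:p:] * q" by blast
    then have "f = p * poly q (Var k)" using poly_as_poly[of k f] by simp
    then show "p dvd f" by simp
  qed
  then show ?thesis by (simp add: const_poly_dvd_iff)
qed

text \<open>Otherwise take the first coefficients of \<open>f\<close> and \<open>g\<close> in
  \<open>k\<close> that \<open>p\<close> does not divide. In the coefficient of \<open>f * g\<close>
  at \<open>i + j\<close> all other summands are divisible by \<open>p\<close>, so \<open>p\<close>
  divides the product of these two, against \<open>primes_in V\<close>.\<close>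

lemma irreducible_prime_lift:
  assumes p: "p \<in> polys_in V" "irreducible p"
    and fg: "f \<in> polys_in (insert k V)" "g \<in> polys_in (insert k V)" "p dvd f * g"
  shows "p dvd f \<or> p dvd g"
proof (rule ccontr)
  let ?f = "\<lambda>i. coeff (as_poly k f) i" and ?g = "\<lambda>i. coeff (as_poly k g) i"
  have coeffs: "?f i \<in> polys_in V" "?g i \<in> polys_in V" for i
    using coeff_as_poly[OF fg(1), of k i] coeff_as_poly[OF fg(2), of k i] k by simp_all
  assume "\<not> ?thesis"
  then have ex: "\<exists>i. \<not> p dvd ?f i" "\<exists>j. \<not> p dvd ?g j" using dvd_iff_dvd_coeffs[OF p(1)] by blast+
  obtain i where i: "\<not> p dvd ?f i" "\<And>l. l < i \<Longrightarrow> p dvd ?f l"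
    proof -
    have "\<exists>i. \<not> p dvd ?f i \<and> (\<forall>l<i. \<not> \<not> p dvd ?f l)"
      using ex(1) by (rule iffD1[OF exists_least_iff])
    then show thesis using that by auto
  qed
  obtain j where j: "\<not> p dvd ?g j" "\<And>l. l < j \<Longrightarrow> p dvd ?g l"
    proof -
    have "\<exists>j. \<not> p dvd ?g j \<and> (\<forall>l<j. \<not> \<not> p dvd ?g l)"
      using ex(2) by (rule iffD1[OF exists_least_iff])
    then show thesis using that by auto
  qed
  have "p dvd ?f l * ?g (i + j - l)" if "l \<in> {..i + j} - {i}" for l
  proof (cases "l < i")
    case False
    then have "i + j - l < j" using that by auto
    then show ?thesis using j(2) by simp
  qed (use i(2) in simp)
  then have "p dvd (\<Sum>l\<in>{..i + j} - {i}. ?f l * ?g (i + j - l))" by (rule dvd_sum)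
  moreover have "p dvd (\<Sum>l\<le>i + j. ?f l * ?g (i + j - l))"
    using fg(3) dvd_iff_dvd_coeffs[OF p(1), of "f * g"] by (simp add: as_poly.hom_mult coeff_mult)
  moreover have "(\<Sum>l\<le>i + j. ?f l * ?g (i + j - l)) =
      ?f i * ?g j + (\<Sum>l\<in>{..i + j} - {i}. ?f l * ?g (i + j - l))"
    using sum.remove[of "{..i + j}" i "\<lambda>l. ?f l * ?g (i + j - l)"] by simp
  ultimately have "p dvd ?f i * ?g j" by (simp add: dvd_add_left_iff)
  then show False using V p coeffs i(1) j(1) unfolding primes_in_def by blast
qed

text \<open>Takes the place of Gauss's lemma: the prime factors of \<open>c\<close> are distributed over \<open>r\<close> and \<open>u\<close> one by one.\<close>

lemma split_common_factor:
  assumes "c \<in> polys_in V" "c \<noteq> 0" "p \<noteq> 0" "r \<in> polys_in (insert k V)" "u \<in> polys_in (insert k V)" "c * p = r * u"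
  shows "\<exists>c1 c2 r' u'. c = c1 * c2 \<and> r = c1 * r' \<and> u = c2 * u' \<and> p = r' * u'"
  using assms
proof (induction "tdeg c" arbitrary: c r u rule: less_induct)
  case less
  show ?case
  proof (cases "tdeg c = 0")
    case True
    then obtain d where d: "c = Const d" using tdeg_eq_0D by blast
    then have "d \<noteq> 0" using less.prems by auto
    then have inv: "Const d * Const (1 / d) = (1 :: 'n mp)" by (simp add: Const.hom_one flip: Const.hom_mult)
    have "r = c * (Const (1 / d) * r)" unfolding d by (simp add: inv flip: mult.assoc)
    moreover have "p = Const (1 / d) * r * u"
      using less.prems(6) inv unfolding d by (metis mult.assoc mult.commute mult.left_neutral)
    ultimately show ?thesis by (intro exI[of _ c] exI[of _ 1] exI[of _ "Const (1 / d) * r"] exI[of _ u]) simp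
  next
    case False
    then obtain q where q: "irreducible q" "q dvd c" using ex_irreducible_factor less.prems by blast
    then obtain c' where c': "c = q * c'" by blast
    have nz: "q \<noteq> 0" "c' \<noteq> 0" "r \<noteq> 0" "u \<noteq> 0" using less.prems c' by auto
    have "\<not> q dvd 1" using q(1) by (simp add: Factorial_Ring.irreducible_def)
    then have lt: "tdeg c' < tdeg c" using tdeg_mult[OF nz(1,2)] nz by (simp add: c' dvd_1_iff_tdeg)
    have qV: "q \<in> polys_in V" "c' \<in> polys_in V"
      using polys_in_factor[OF less.prems(1,2)] c' by auto
    have "q dvd r * u" using less.prems(6) c' by (metis dvd_triv_left mult.assoc)
    then consider "q dvd r" | "q dvd u" using irreducible_prime_lift[OF qV(1) q(1) less.prems(4,5)] by blast
    then show ?thesis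
    proof cases
      case 1
      then obtain r0 where r0: "r = q * r0" by blast
      have "r0 \<in> polys_in (insert k V)" using polys_in_factor[OF less.prems(4) nz(3)] r0 by simp
      moreover have "c' * p = r0 * u" using less.prems(6) nz(1) unfolding c' r0 by (simp add: mult.assoc)
      ultimately obtain c1 c2 r' u' where "c' = c1 * c2" "r0 = c1 * r'" "u = c2 * u'" "p = r' * u'"
        using less.hyps[OF lt qV(2) nz(2) less.prems(3) _ less.prems(5)] by blast
      then show ?thesis unfolding c' r0
        by (intro exI[of _ "q * c1"] exI[of _ c2] exI[of _ r'] exI[of _ u']) (simp add: mult.assoc)
    next
      case 2
      then obtain u0 where u0: "u = q * u0" by blast
      have "u0 \<in> polys_in (insert k V)" using polys_in_factor[OF less.prems(5) nz(4)] u0 by simp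
      moreover have "c' * p = r * u0" using less.prems(6) nz(1) unfolding c' u0 by (simp add: ac_simps)
      ultimately obtain c1 c2 r' u' where "c' = c1 * c2" "r = c1 * r'" "u0 = c2 * u'" "p = r' * u'"
        using less.hyps[OF lt qV(2) nz(2) less.prems(3,4)] by blast
      then show ?thesis unfolding c' u0
        by (intro exI[of _ c1] exI[of _ "q * c2"] exI[of _ r'] exI[of _ u']) (simp add: ac_simps)
    qed
  qed
qed

lemma degree_as_poly_unit: "f dvd 1 \<Longrightarrow> degree (as_poly k f) = 0"
  using tdeg_eq_0D[of f] by (metis dvd_1_iff_tdeg as_poly_Const degree_pCons_0)

text \<open>Distribute \<open>c\<close> over the two factors of \<open>p * w\<close>. The part
  \<open>c1\<close> that falls to \<open>p\<close> is free of \<open>k\<close>, so irreducibility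
  and the positive degree of \<open>p\<close> in \<open>k\<close> make it a unit, and the rest of
  \<open>p\<close> divides \<open>f\<close>.\<close>

lemma cancel_constant:
  assumes p: "p \<in> polys_in (insert k V)" "irreducible p" "degree (as_poly k p) \<noteq> 0"
    and c: "c \<in> polys_in V" "c \<noteq> 0" and f: "f \<in> polys_in (insert k V)" "p dvd c * f"
  shows "p dvd f"
proof (cases "f = 0")
  case False
  obtain w where w: "c * f = p * w" using f(2) by blast
  have cf: "c * f \<in> polys_in (insert k V)" using c(1) f(1) polys_in_mono[of c V "insert k V"] by (auto intro: polys_in.mult)
  have "c * f \<noteq> 0" using c(2) False by simp
  moreover have "w dvd c * f" unfolding w by simp
  ultimately have "w \<in> polys_in (insert k V)" by (rule polys_in_factor[OF cf])
  then obtain c1 c2 p' w' where *: "c = c1 * c2" "p = c1 * p'" "w = c2 * w'" "f = p' * w'"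
    using split_common_factor[OF c False p(1) _ w] by blast
  have "c1 \<in> polys_in V" using polys_in_factor[OF c] *(1) by simp
  have "p \<noteq> 0" using p(2) by (simp add: Factorial_Ring.irreducible_def)
  then have nz: "c1 \<noteq> 0" "p' \<noteq> 0" using * by auto
  have "c1 dvd 1 \<or> p' dvd 1" using p(2) *(2) by (auto simp: Factorial_Ring.irreducible_def)
  moreover have "\<not> p' dvd 1"
  proof
    assume "p' dvd 1"
    then have "degree (as_poly k (c1 * p')) = 0"
      unfolding degree_as_poly_mult[OF nz] as_poly_const[OF \<open>c1 \<in> polys_in V\<close> k]
      by (simp add: degree_as_poly_unit)
    then show False using p(3) by (simp flip: *(2))
  qed
  ultimately have "c1 dvd 1" by blast
  then obtain e where "1 = c1 * e" by blast
  from arg_cong[OF this, of "\<lambda>x. p' * x"] have "p' = p * e" unfolding *(2) by (simp add: ac_simps)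
  then show ?thesis using *(4) by simp
qed simp

text \<open>A nonzero element \<open>r\<close> of least degree in \<open>k\<close> in the ideal of
  \<open>p\<close> and \<open>f\<close> divides both of them up to a power of its leading
  coefficient, since a pseudo-remainder would be a smaller element. If its degree were positive,
  irreducibility of \<open>p\<close> would make \<open>r\<close> a multiple of \<open>p\<close>, so
  \<open>p\<close> would divide \<open>f\<close> up to a factor free of \<open>k\<close>, which
  \<open>cancel_constant\<close> removes.\<close>

lemma elimination:
  assumes p: "p \<in> polys_in (insert k V)" "irreducible p" "degree (as_poly k p) \<noteq> 0"
    and f: "f \<in> polys_in (insert k V)" "\<not> p dvd f"
  shows "\<exists>r\<in>polys_in V. r \<noteq> 0 \<and> (\<exists>u v. r = u * p + v * f)"
proof -
  define I where "I r \<longleftrightarrow> r \<in> polys_in (insert k V) \<and> r \<noteq> 0 \<and> (\<exists>u v. r = u * p + v * f)" for r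
  have "p \<noteq> 0" using p(2) by (simp add: Factorial_Ring.irreducible_def)
  have "f \<noteq> 0" using f(2) by auto
  have "p = 1 * p + 0 * f" by simp
  then have "I p" unfolding I_def using p(1) \<open>p \<noteq> 0\<close> by blast
  then obtain r where r: "I r" "\<And>s. I s \<Longrightarrow> degree (as_poly k r) \<le> degree (as_poly k s)"
    using ex_has_least_nat[of I p "\<lambda>r. degree (as_poly k r)"] by blast
  then obtain u v where uv: "r = u * p + v * f" and rV: "r \<in> polys_in (insert k V)" "r \<noteq> 0"
    by (auto simp: I_def)
  have coeffs: "coeff (as_poly k g) i \<in> polys_in V" if "g \<in> polys_in (insert k V)" for g i
    using coeff_as_poly[OF that, of k i] k by simp
  note S = subring_set_polys_in[of V]
  define l where "l = lead_coeff (as_poly k r)"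
  have l: "l \<in> polys_in V" "l \<noteq> 0" using coeffs[OF rV(1)] rV(2) by (simp_all add: l_def)
  have divides: "\<exists>m h. l ^ m * g = r * h \<and> h \<in> polys_in (insert k V)"
    if g: "g \<in> polys_in (insert k V)" "g = x * p + y * f" for g x y
  proof -
    obtain m h s where *: "smult (l ^ m) (as_poly k g) = as_poly k r * h + s"
      "s = 0 \<or> degree s < degree (as_poly k r)" "\<forall>i. coeff h i \<in> polys_in V" "\<forall>i. coeff s i \<in> polys_in V"
      using pseudo_division[OF S coeffs[OF g(1)] coeffs[OF rV(1)]] rV(2) unfolding l_def by auto
    have eq: "l ^ m * g = r * poly h (Var k) + poly s (Var k)"
      using arg_cong[OF *(1), of "\<lambda>q. poly q (Var k)"] by (simp add: poly_as_poly)
    have "s = 0"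
    proof (rule ccontr)
      assume "s \<noteq> 0"
      have s: "as_poly k (poly s (Var k)) = s" using as_poly_poly_Var[OF _ k] *(4) by blast
      have "poly s (Var k) = (l ^ m * x - u * poly h (Var k)) * p + (l ^ m * y - v * poly h (Var k)) * f"
        using eq unfolding g(2) uv by (simp add: algebra_simps)
      moreover have "poly s (Var k) \<noteq> 0" using s \<open>s \<noteq> 0\<close> by (metis as_poly_eq_0_iff)
      moreover have "poly s (Var k) \<in> polys_in (insert k V)"
        by (rule poly_Var_polys_in) (use *(4) in blast)
      ultimately have "I (poly s (Var k))" unfolding I_def by blast
      then show False using r(2)[of "poly s (Var k)"] *(2) \<open>s \<noteq> 0\<close> by (simp add: s)
    qed
    moreover have "poly h (Var k) \<in> polys_in (insert k V)" by (rule poly_Var_polys_in) (use *(3) in blast)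
    ultimately show ?thesis using eq by (intro exI[of _ m] exI[of _ "poly h (Var k)"]) simp
  qed
  have "degree (as_poly k r) = 0"
  proof (rule ccontr)
    assume deg: "degree (as_poly k r) \<noteq> 0"
    have powV: "l ^ m \<in> polys_in V" "l ^ m \<noteq> 0" for m using l subring_power[OF S] by auto
    obtain m h where mh: "l ^ m * p = r * h" "h \<in> polys_in (insert k V)"
      using divides[OF p(1), of 1 0] by auto
    obtain c1 c2 r' h' where *: "l ^ m = c1 * c2" "r = c1 * r'" "h = c2 * h'" "p = r' * h'"
      using split_common_factor[OF powV \<open>p \<noteq> 0\<close> rV(1) mh(2,1)] by blast
    have nz: "c1 \<noteq> 0" "r' \<noteq> 0" using * rV(2) by auto
    have "c1 dvd l ^ m" unfolding *(1) by simp
    then have "c1 \<in> polys_in V" by (rule polys_in_factor[OF powV])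
    have "\<not> r' dvd 1"
    proof
      assume "r' dvd 1"
      then have "degree (as_poly k (c1 * r')) = 0"
        unfolding degree_as_poly_mult[OF nz] as_poly_const[OF \<open>c1 \<in> polys_in V\<close> k]
        by (simp add: degree_as_poly_unit)
      then show False using deg by (simp flip: *(2))
    qed
    then have "h' dvd 1" using p(2) *(4) unfolding Factorial_Ring.irreducible_def by blast
    then obtain e where e: "1 = h' * e" by blast
    have "r = p * (c1 * e)"
      using arg_cong[OF e, of "\<lambda>x. r * x"] unfolding *(2,4) by (simp add: ac_simps)
    then have "p dvd r" by simp
    obtain m' h'' where "l ^ m' * f = r * h''" using divides[OF f(1), of 0 1] by auto
    then have "p dvd l ^ m' * f" using \<open>p dvd r\<close> by simp
    then show False using cancel_constant[OF p powV f(1)] f(2) by blast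
  qed
  from polys_in_if_degree_0[OF rV(1) this] have "r \<in> polys_in V" using k by simp
  then show ?thesis using rV(2) uv by blast
qed

text \<open>If \<open>p\<close> involves \<open>k\<close> and does not divide \<open>f\<close>, then
  \<open>elimination\<close> yields a Bezout identity for some nonzero \<open>r\<close> free of
  \<open>k\<close>. Multiplied by \<open>g\<close>, it shows that \<open>p\<close> divides
  \<open>r * g\<close>, and \<open>r\<close> can be cancelled.\<close>

lemma primes_in_insert: "primes_in (insert k V)"
  unfolding primes_in_def
proof (intro ballI impI)
  fix p f g assume p: "p \<in> polys_in (insert k V)" "irreducible p"
    and fg: "f \<in> polys_in (insert k V)" "g \<in> polys_in (insert k V)" "p dvd f * g"
  show "p dvd f \<or> p dvd g"
  proof (cases "degree (as_poly k p) = 0")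
    case True
    have "p \<in> polys_in V" using polys_in_if_degree_0[OF p(1) True] k by simp
    then show ?thesis using irreducible_prime_lift p(2) fg by blast
  next
    case False
    show ?thesis
    proof (cases "p dvd f")
      case nf: False
      obtain r u v where r: "r \<in> polys_in V" "r \<noteq> 0" "r = u * p + v * f"
        using elimination[OF p False fg(1) nf] by blast
      have "r * g = p * (u * g) + v * (f * g)" unfolding r(3) by (simp add: algebra_simps)
      then have "p dvd r * g" using fg(3) by simp
      then show ?thesis using cancel_constant[OF p False r(1,2) fg(2)] by blast
    qed simp
  qed
qed

end

lemma primes_in: "primes_in V"
  using finite[of V]
proof (induction V)
  case empty
  have "f dvd 1 \<or> f = 0" if "f \<in> polys_in {}" for f :: "'a mp"
    using polys_in_empty[OF that] by (metis Const.hom_zero Const_dvd_1)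
  then show ?case by (auto simp: primes_in_def Factorial_Ring.irreducible_def)
qed (rule primes_in_insert)

section \<open>Polynomials vanishing on the zeros of an indefinite irreducible polynomial\<close>

lemma eval_sign_near:
  assumes "evalp p a \<noteq> 0"
  shows "\<exists>e>0. \<forall>x. (\<forall>i. \<bar>x $ i - a $ i\<bar> < e) \<longrightarrow> 0 < evalp p x * evalp p a"
  using eval_pos_near[of "p * Const (evalp p a)" a] assms
  by (auto simp: evalp.hom_mult zero_less_mult_iff neq_iff)

text \<open>Walk from \<open>a\<close> to \<open>b\<close> changing one coordinate at a time. A corner of the path at which \<open>p\<close> vanishes is
  avoided by translating the whole path slightly.\<close>

lemma sign_change_along_coordinate:
  fixes p :: "'n::finite mp"
  assumes "evalp p a * evalp p b < 0"
  shows "\<exists>k c u. evalp p c * evalp p (\<chi> i. if i = k then u else c $ i) < 0"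
proof -
  have "\<exists>k c u. evalp p c * evalp p (\<chi> i. if i = k then u else c $ i) < 0"
    if "evalp p a * evalp p b < 0" "\<And>i. i \<notin> W \<Longrightarrow> a $ i = b $ i" for W :: "'n set" and a b
    using finite[of W] that
  proof (induction W arbitrary: a b)
    case empty
    then have "a = b" by (simp add: vec_eq_iff)
    then show ?case using empty by (simp add: not_less[symmetric])
  next
    case (insert k W)
    have nz: "evalp p a \<noteq> 0" "evalp p b \<noteq> 0" using insert.prems(1) by auto
    obtain d where d: "d > 0" "\<And>x. (\<forall>i. \<bar>x $ i - a $ i\<bar> < d) \<Longrightarrow> 0 < evalp p x * evalp p a"
      using eval_sign_near[OF nz(1)] by blast
    obtain e where e: "e > 0" "\<And>x. (\<forall>i. \<bar>x $ i - b $ i\<bar> < e) \<Longrightarrow> 0 < evalp p x * evalp p b"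
      using eval_sign_near[OF nz(2)] by blast
    define c where "c = (\<chi> i. if i = k then b $ i else a $ i)"
    have "p \<noteq> 0" using nz by auto
    then obtain c' where c': "\<forall>i. \<bar>c' $ i - c $ i\<bar> < min d e" "evalp p c' \<noteq> 0"
      using eval_nonzero_near[of p "min d e" c] d e by auto
    define a' where "a' = a + (c' - c)"
    define b' where "b' = b + (c' - c)"
    have "0 < evalp p a' * evalp p a" by (rule d(2)) (use c'(1) in \<open>simp add: a'_def\<close>)
    moreover have "0 < evalp p b' * evalp p b" by (rule e(2)) (use c'(1) in \<open>simp add: b'_def\<close>)
    ultimately have "evalp p a' * evalp p b' < 0"
      using insert.prems(1) by (auto simp: zero_less_mult_iff mult_less_0_iff)
    \<comment> \<open>The first leg changes only the coordinate \<open>k\<close>, the second only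
      coordinates in \<open>W\<close>.\<close>
    then consider "evalp p a' * evalp p c' < 0" | "evalp p c' * evalp p b' < 0"
      using c'(2) by (auto simp: mult_less_0_iff neq_iff)
    then show ?case
    proof cases
      case 1
      have "c' = (\<chi> i. if i = k then c' $ k else a' $ i)"
        by (simp add: vec_eq_iff a'_def c_def)
      then show ?thesis using 1 by metis
    next
      case 2
      show ?thesis
        by (rule insert.IH[OF 2]) (use insert.prems(2) in \<open>auto simp: b'_def c_def\<close>)
    qed
  qed
  from this[of a b UNIV] show ?thesis using assms by simp
qed

lemma irreducible_dvd_if_vanishes:
  fixes p h :: "'n::finite mp"
  assumes p: "irreducible p" "evalp p a * evalp p b < 0"
    and h: "\<And>x. evalp p x = 0 \<Longrightarrow> evalp h x = 0"
  shows "p dvd h"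
proof (rule ccontr)
  assume "\<not> p dvd h"
  obtain k c u where c: "evalp p c * evalp p (\<chi> i. if i = k then u else c $ i) < 0"
    using sign_change_along_coordinate[OF p(2)] by blast
  let ?upd = "\<lambda>x u. \<chi> i. if i = k then u else x $ i"
  have U: "insert k (UNIV - {k}) = UNIV" by auto
  have "degree (as_poly k p) \<noteq> 0"
  proof
    assume "degree (as_poly k p) = 0"
    then have "p \<in> polys_in (UNIV - {k})" by (rule polys_in_if_degree_0[OF polys_in_UNIV])
    then have "evalp p (?upd c u) = evalp p c" by (rule eval_cong) auto
    then show False using c by (simp add: not_less[symmetric])
  qed
  then obtain r v w where r: "r \<in> polys_in (UNIV - {k})" "r \<noteq> 0" "r = v * p + w * h"
    using elimination[OF primes_in, of k "UNIV - {k}" p h] p(1) \<open>\<not> p dvd h\<close> unfolding U by (auto simp: polys_in_UNIV)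
  have nz: "evalp p c \<noteq> 0" "evalp p (?upd c u) \<noteq> 0" using c by auto
  obtain d where d: "d > 0" "\<And>x. (\<forall>i. \<bar>x $ i - c $ i\<bar> < d) \<Longrightarrow> 0 < evalp p x * evalp p c"
    using eval_sign_near[OF nz(1)] by blast
  obtain e where e: "e > 0" "\<And>x. (\<forall>i. \<bar>x $ i - ?upd c u $ i\<bar> < e) \<Longrightarrow> 0 < evalp p x * evalp p (?upd c u)"
    using eval_sign_near[OF nz(2)] by blast
  \<comment> \<open>Near \<open>c\<close> the sign change along \<open>k\<close> persists, so
    \<open>x\<close> may be chosen with \<open>r\<close> nonzero there.\<close>
  obtain x where x: "\<forall>i. \<bar>x $ i - c $ i\<bar> < min d e" "evalp r x \<noteq> 0"
    using eval_nonzero_near[OF r(2), of "min d e" c] d e by auto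
  have "0 < evalp p x * evalp p c" by (rule d(2)) (use x in auto)
  moreover have "0 < evalp p (?upd x u) * evalp p (?upd c u)" by (rule e(2)) (use x e(1) in auto)
  ultimately have sign: "evalp p x * evalp p (?upd x u) < 0"
    using c by (auto simp: zero_less_mult_iff mult_less_0_iff)
  let ?q = "map_poly (\<lambda>c. evalp c x) (as_poly k p)"
  have eval_upd: "evalp p (?upd x t) = poly ?q t" for t by (rule eval_as_poly)
  have "?upd x (x $ k) = x" by (simp add: vec_eq_iff)
  then have sign': "poly ?q (x $ k) * poly ?q u < 0" using sign eval_upd by metis
  \<comment> \<open>The line through \<open>x\<close> in direction \<open>k\<close> meets a zero of
    \<open>p\<close>, where \<open>h\<close> and hence \<open>r\<close> vanish; but \<open>r\<close>
    is constant along this line.\<close>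
  have "\<exists>t. poly ?q t = 0"
  proof (cases "x $ k" u rule: linorder_cases)
    case less
    then show ?thesis using poly_sign_change'[OF less sign'] by blast
  next
    case equal
    then show ?thesis using sign' by (simp add: not_less[symmetric])
  next
    case greater
    then show ?thesis using poly_sign_change'[OF greater, of ?q] sign' by (auto simp: mult.commute)
  qed
  then obtain t where "evalp p (?upd x t) = 0" using eval_upd by metis
  then have "evalp r (?upd x t) = 0" unfolding r(3) by (simp add: evalp.hom_add evalp.hom_mult h)
  moreover have "evalp r (?upd x t) = evalp r x" by (rule eval_cong[OF r(1)]) auto
  ultimately show False using x(2) by simp
qed

section \<open>Minimal denominators\<close>

lemma sos_iff: "sos F \<longleftrightarrow> Mp F \<in> sos_in UNIV"
proof
  assume "sos F"
  then obtain k :: nat and h where F: "F = (\<Sum>i=1..k. (h i)\<^sup>2)" by (auto simp: sos_def)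
  have "Mp (\<Sum>i=1..k. (h i)\<^sup>2) \<in> sos_in UNIV"
  proof (induction k)
    case (Suc k)
    have "Mp (\<Sum>i=1..Suc k. (h i)\<^sup>2) = Mp (h (Suc k)) * Mp (h (Suc k)) + Mp (\<Sum>i=1..k. (h i)\<^sup>2)"
      by (simp add: plus_mp.abs_eq times_mp.abs_eq eq_onp_def power2_eq_square add.commute)
    then show ?case using Suc by (simp add: sos_in.add)
  qed (simp add: sos_in.zero flip: zero_mp.abs_eq)
  then show "Mp F \<in> sos_in UNIV" by (simp add: F)
next
  have "sos (raw f)" if "f \<in> sos_in UNIV" for f :: "'a mp"
    using that
  proof induction
    case zero
    show ?case unfolding sos_def by (intro exI[of _ 0]) (simp add: zero_mp.rep_eq)
  next
    case (add x y)
    then obtain k :: nat and h where y: "raw y = (\<Sum>i=1..k. (h i)\<^sup>2)" by (auto simp: sos_def)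
    have "raw (x * x + y) = (\<Sum>i=1..Suc k. ((h(Suc k := raw x)) i)\<^sup>2)"
      by (simp add: plus_mp.rep_eq times_mp.rep_eq y power2_eq_square add.commute)
    then show ?case unfolding sos_def by blast
  qed
  from this[of "Mp F"] show "Mp F \<in> sos_in UNIV \<Longrightarrow> sos F" by (simp add: Mp_inverse)
qed

lemma artin_denominator_raw: "artin_denominator (raw f) (raw s) \<longleftrightarrow> s \<noteq> 0 \<and> s * s * f \<in> sos_in UNIV"
proof -
  have "raw (s * s * f) = (raw s)\<^sup>2 * raw f"
    by (simp add: times_mp.rep_eq power2_eq_square)
  then have "Mp ((raw s)\<^sup>2 * raw f) = s * s * f" by (metis raw_inverse)
  moreover have "raw s = 0 \<longleftrightarrow> s = 0" by (metis raw_inject zero_mp.rep_eq)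
  ultimately show ?thesis by (simp add: artin_denominator_def sos_iff)
qed

lemma raw_cases: obtains f where "F = raw f"
  using Mp_inverse[OF UNIV_I, of F] by metis

lemma raw_mult_eq_iff: "raw a * raw b = raw c \<longleftrightarrow> a * b = c"
  using raw_inject[of "a * b" c] by (simp only: times_mp.rep_eq)

lemma unit_raw: "raw a dvd 1 \<longleftrightarrow> a dvd 1"
proof
  assume "raw a dvd 1"
  then obtain B where B: "1 = raw a * B" by blast
  obtain b where "B = raw b" by (rule raw_cases)
  then have "a * b = 1" using B raw_mult_eq_iff[of a b 1] one_mp.rep_eq by metis
  then show "a dvd 1" by (metis dvd_triv_left)
next
  assume "a dvd 1"
  then obtain b where "1 = a * b" by blast
  then have "raw a * raw b = 1" using raw_mult_eq_iff[of a b 1] one_mp.rep_eq by metis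
  then show "raw a dvd 1" by (metis dvd_triv_left)
qed

lemma irreducible_raw: "irreducible (raw p) \<longleftrightarrow> irreducible p"
proof -
  have "(\<forall>a b. raw p = a * b \<longrightarrow> a dvd 1 \<or> b dvd 1) \<longleftrightarrow> (\<forall>a b. raw p = raw a * raw b \<longrightarrow> raw a dvd 1 \<or> raw b dvd 1)"
    by (metis raw_cases)
  moreover have "raw p = 0 \<longleftrightarrow> p = 0" by (metis raw_inject zero_mp.rep_eq)
  moreover have "raw p = raw a * raw b \<longleftrightarrow> p = a * b" for a b using raw_mult_eq_iff[of a b p] by auto
  ultimately show ?thesis unfolding Factorial_Ring.irreducible_def unit_raw by simp
qed

lemma constant_mpoly_raw: "constant_mpoly (raw f) \<longleftrightarrow> (\<exists>c. f = Const c)"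
  unfolding constant_mpoly_def by (metis Const.rep_eq raw_inject)

lemma artin_minimal_denominator_raw:
  "artin_minimal_denominator (raw f) (raw s) \<longleftrightarrow> s \<noteq> 0 \<and> s * s * f \<in> sos_in UNIV \<and>
    (\<forall>p q. irreducible p \<and> s = p * q \<longrightarrow> q * q * f \<notin> sos_in UNIV)"
proof -
  have "(\<forall>p q. irreducible p \<and> raw s = p * q \<longrightarrow> \<not> artin_denominator (raw f) q) \<longleftrightarrow>
    (\<forall>p q. irreducible p \<and> s = p * q \<longrightarrow> \<not> artin_denominator (raw f) (raw q))"
    (is "?L \<longleftrightarrow> ?R")
  proof
    assume ?L
    then show ?R using irreducible_raw times_mp.rep_eq by metis
  next
    assume R: ?R
    show ?L
    proof (intro allI impI)
      fix p q assume pq: "irreducible p \<and> raw s = p * q"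
      obtain p' q' where "p = raw p'" "q = raw q'" by (metis raw_cases)
      then show "\<not> artin_denominator (raw f) q"
        using pq R irreducible_raw[of p'] raw_mult_eq_iff[of p' q' s] by metis
    qed
  qed
  moreover have "s \<noteq> 0 \<Longrightarrow> s = p * q \<Longrightarrow> q \<noteq> 0" for p q by auto
  ultimately show ?thesis unfolding artin_minimal_denominator_def artin_denominator_raw by blast
qed

lemma ex_minimal_denominator:
  fixes f :: "'n::finite mp"
  assumes "\<And>x. 0 \<le> evalp f x"
  shows "\<exists>s. s \<noteq> 0 \<and> s * s * f \<in> sos_in UNIV \<and>
    (\<forall>p q. irreducible p \<and> s = p * q \<longrightarrow> q * q * f \<notin> sos_in UNIV)"
proof -
  obtain s where s: "s \<noteq> 0" "s * s * f \<in> sos_in UNIV"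
    "\<And>t. t \<noteq> 0 \<Longrightarrow> t * t * f \<in> sos_in UNIV \<Longrightarrow> tdeg s \<le> tdeg t"
    using hilbert17[OF assms] ex_has_least_nat[of "\<lambda>s. s \<noteq> 0 \<and> s * s * f \<in> sos_in UNIV" _ tdeg] by blast
  have "q * q * f \<notin> sos_in UNIV" if pq: "irreducible p" "s = p * q" for p q
  proof
    assume "q * q * f \<in> sos_in UNIV"
    have nz: "p \<noteq> 0" "q \<noteq> 0" using s(1) pq(2) by auto
    have "\<not> p dvd 1" using pq(1) by (simp add: Factorial_Ring.irreducible_def)
    then have "tdeg q < tdeg s" using tdeg_mult[OF nz] nz unfolding pq(2) by (simp add: dvd_1_iff_tdeg)
    then show False using s(3)[OF nz(2) \<open>q * q * f \<in> sos_in UNIV\<close>] by simp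
  qed
  then show ?thesis using s(1,2) by blast
qed

lemma Const_denominator:
  assumes "Const c \<noteq> 0" "Const c * Const c * f \<in> sos_in UNIV"
  shows "f \<in> sos_in UNIV"
proof -
  have "c \<noteq> 0" using assms(1) by auto
  then have "f = Const (1 / c) * Const (1 / c) * (Const c * Const c * f)"
    by (simp add: Const.hom_one flip: mult.assoc Const.hom_mult)
  also have "\<dots> \<in> sos_in UNIV"
    by (intro sos_in_mult[OF subring_set_UNIV] sos_in_square assms(2)) simp
  finally show ?thesis .
qed

text \<open>Where \<open>x * x + y\<close> vanishes, both summands do, so the squares can be split
  off one at a time, each with a base divisible by \<open>p\<close>. The quotient by
  \<open>p * p\<close> is again a sum of squares, which is what removing \<open>p\<close> from a
  denominator requires.\<close>

lemma sos_in_vanishing: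
  assumes "f \<in> sos_in UNIV" "irreducible p" "evalp p a * evalp p b < 0" "\<And>x. evalp p x = 0 \<Longrightarrow> evalp f x = 0"
  shows "\<exists>g\<in>sos_in UNIV. f = p * p * g"
  using assms(1,4)
proof induction
  case zero
  show ?case by (intro bexI[of _ 0]) (simp_all add: sos_in.zero)
next
  case (add x y)
  have "evalp x z = 0 \<and> evalp y z = 0" if "evalp p z = 0" for z
  proof -
    have "evalp x z * evalp x z + evalp y z = 0"
      using add.prems[OF that] by (simp add: evalp.hom_add evalp.hom_mult)
    then show ?thesis using eval_sos_in_nonneg[OF add.hyps(2), of z]
      by (metis add_nonneg_eq_0_iff mult_eq_0_iff zero_le_square)
  qed
  then obtain g u where "g \<in> sos_in UNIV" "y = p * p * g" "x = p * u"
    using add.IH irreducible_dvd_if_vanishes[OF assms(2,3), of x] by (metis dvdE)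
  then show ?case by (intro bexI[of _ "u * u + g"] sos_in.add) (simp_all add: algebra_simps)
qed

theorem theorem1p1:
  fixes F :: "'n::finite real_mpoly"
  assumes "psd F" and "\<not> sos F"
  shows "(\<exists>s. artin_minimal_denominator F s \<and> \<not> constant_mpoly s) \<and>
         (\<forall>s. artin_minimal_denominator F s \<longrightarrow>
            (\<forall>p. irreducible p \<and> p dvd s \<longrightarrow> no_sign_change p))"
proof -
  obtain f where F: "F = raw f" by (rule raw_cases)
  have nonneg: "0 \<le> evalp f x" for x using assms(1) by (simp add: psd_def F eval_mpoly_raw)
  have "f \<notin> sos_in UNIV" using assms(2) by (simp add: F sos_iff raw_inverse)
  obtain s where s: "artin_minimal_denominator F (raw s)" "s \<noteq> 0" "s * s * f \<in> sos_in UNIV"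
    using ex_minimal_denominator[OF nonneg] unfolding F artin_minimal_denominator_raw by blast
  have "\<not> constant_mpoly (raw s)"
    unfolding constant_mpoly_raw using Const_denominator s \<open>f \<notin> sos_in UNIV\<close> by blast
  moreover have "no_sign_change P"
    if min: "artin_minimal_denominator F S" and P: "irreducible P" "P dvd S" for S P
  proof (rule ccontr)
    assume sign: "\<not> no_sign_change P"
    obtain Q where Q: "S = P * Q" using P(2) by blast
    obtain p q where pq: "P = raw p" "Q = raw q" by (metis raw_cases)
    have S: "S = raw (p * q)" by (simp add: Q pq times_mp.rep_eq)
    have p: "irreducible p" using P(1) by (simp add: pq irreducible_raw)
    have pqf: "p * q \<noteq> 0" "(p * q) * (p * q) * f \<in> sos_in UNIV" "q * q * f \<notin> sos_in UNIV"
      using min p unfolding F S artin_minimal_denominator_raw by blast+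
    obtain a b where "evalp p a < 0" "0 < evalp p b"
      using sign by (auto simp: no_sign_change_def pq eval_mpoly_raw not_le)
    then have "evalp p a * evalp p b < 0" by (rule mult_neg_pos)
    from sos_in_vanishing[OF pqf(2) p this] obtain g where g: "g \<in> sos_in UNIV" "(p * q) * (p * q) * f = p * p * g"
      by (auto simp: evalp.hom_mult)
    have "p * p \<noteq> 0" using pqf(1) by auto
    moreover have "p * p * (q * q * f) = p * p * g" using g(2) by (simp add: ac_simps)
    ultimately have "q * q * f = g" by (metis mult_left_cancel)
    then show False using g(1) pqf(3) by simp
  qed
  ultimately show ?thesis using s(1) by blast
qed

end
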